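(* Let $K$ be a field of characteristic $0$, let $\Lambda\subset K$ be a finite set of distinct non-zero elements, let $r_0,r_1,r_2$ be any positive integers, and let $$F_\Lambda=(x^{r_0}+y^{r_1})\prod_{\alpha\in\Lambda}(x^{r_0}+y^{r_1}+\alpha z^{r_2})\in K[x,y,z].$$ Let $F_\Lambda^h\in K[x,y,z,t]$ be the homogenization of $F_\Lambda$ with respect to $t$. Then the divisor in $\mathbb{P}^3$ defined by the homogeneous polynomial $t\cdot F_\Lambda^h$ is free with exponents $$(1,\ \max\{r_0,r_1\}-1,\ |\Lambda|\cdot\max\{r_0,r_1,r_2\}).$$ In particular, if $r_0\le r_1\le r_2$, then the divisor in $\mathbb{P}^3$ defined by $$t\,(t^{r_1-r_0}x^{r_0}+y^{r_1})\prod_{\alpha\in\Lambda}(t^{r_2-r_0}x^{r_0}+t^{r_2-r_1}y^{r_1}+\alpha z^{r_2})$$ is free with exponents $(1,\ r_1-1,\ |\Lambda|r_2)$.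
   Context: For a reduced homogeneous polynomial $f\in S=K[x,y,z,t]$ (standard grading), $\mathrm{Der}_0(f)=\{\delta\in\mathrm{Der}_K(S):\delta(f)=0\}$; a derivation is homogeneous of degree $a$ if all its coefficients on the partial derivatives are homogeneous of degree $a$ (or zero). The divisor $V(f)\subset\mathbb{P}^3$ is free with exponents $(a_1,a_2,a_3)$ if $\mathrm{Der}_0(f)$ is a free $S$-module with a basis of three homogeneous derivations of degrees $a_1,a_2,a_3$ (in any order). $|\Lambda|$ denotes cardinality. *)

theory Defs
  imports
    Complex_Main
    "HOL-Library.Poly_Mapping"
    "HOL-Library.Function_Algebras"
    "HOL-Computational_Algebra.Squarefree"
begin

section \<open>The polynomial ring \<open>S = K[x,y,z,t]\<close>\<close>

datatype indet = IX | IY | IZ | IT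

lemma UNIV_indet: "(UNIV :: indet set) = {IX, IY, IZ, IT}"
  using indet.exhaust by auto

instance indet :: finite
  by standard (simp add: UNIV_indet)

type_synonym monom4 = "indet \<Rightarrow>\<^sub>0 nat"

type_synonym 'a poly4 = "monom4 \<Rightarrow>\<^sub>0 'a"

definition Cst :: "'a::comm_ring_1 \<Rightarrow> 'a poly4" where
  "Cst c = Poly_Mapping.single 0 c"

definition Var :: "indet \<Rightarrow> 'a::comm_ring_1 poly4" where
  "Var v = Poly_Mapping.single (Poly_Mapping.single v 1) 1"

definition mon_degree :: "monom4 \<Rightarrow> nat" where
  "mon_degree m = (\<Sum>v\<in>UNIV. Poly_Mapping.lookup m v)"

text \<open>The zero polynomial is homogeneous of every degree.\<close>

definition homogeneous :: "nat \<Rightarrow> 'a::comm_ring_1 poly4 \<Rightarrow> bool" where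
  "homogeneous d p \<longleftrightarrow> (\<forall>m\<in>Poly_Mapping.keys p. mon_degree m = d)"

definition total_degree :: "'a::comm_ring_1 poly4 \<Rightarrow> nat" where
  "total_degree p = Max (insert 0 (mon_degree ` Poly_Mapping.keys p))"

text \<open>
  Homogenization with respect to \<open>t\<close>, to be applied to elements of \<open>K[x,y,z]\<close>, regarded as the
  polynomials in \<open>S\<close> in which \<open>t\<close> does not occur.
\<close>

definition homogenize :: "'a::comm_ring_1 poly4 \<Rightarrow> 'a poly4" where
  "homogenize p = (\<Sum>m\<in>Poly_Mapping.keys p.
     Poly_Mapping.single (m + Poly_Mapping.single IT (total_degree p - mon_degree m))
       (Poly_Mapping.lookup p m))"

section \<open>Derivations\<close>

text \<open>
  In \<open>pdiff\<close>, the truncated subtraction only truncates when the exponent of \<open>v\<close> is \<open>0\<close>, and then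
  the coefficient vanishes.
\<close>

definition pdiff :: "indet \<Rightarrow> 'a::comm_ring_1 poly4 \<Rightarrow> 'a poly4" where
  "pdiff v p = (\<Sum>m\<in>Poly_Mapping.keys p.
     Poly_Mapping.single (m - Poly_Mapping.single v 1)
       (of_nat (Poly_Mapping.lookup m v) * Poly_Mapping.lookup p m))"

definition Der :: "('a::comm_ring_1 poly4 \<Rightarrow> 'a poly4) set" where
  "Der = {\<delta>. (\<forall>p q. \<delta> (p + q) = \<delta> p + \<delta> q) \<and>
              (\<forall>c p. \<delta> (Cst c * p) = Cst c * \<delta> p) \<and>
              (\<forall>p q. \<delta> (p * q) = p * \<delta> q + q * \<delta> p)}"

definition Der0 :: "'a::comm_ring_1 poly4 \<Rightarrow> ('a poly4 \<Rightarrow> 'a poly4) set" where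
  "Der0 f = {\<delta> \<in> Der. \<delta> f = 0}"

definition homogeneous_der :: "nat \<Rightarrow> ('a::comm_ring_1 poly4 \<Rightarrow> 'a poly4) \<Rightarrow> bool" where
  "homogeneous_der a \<delta> \<longleftrightarrow>
     (\<exists>c. (\<forall>v. homogeneous a (c v)) \<and> (\<forall>p. \<delta> p = (\<Sum>v\<in>UNIV. c v * pdiff v p)))"

text \<open>
  The \<open>S\<close>-module structure on maps \<open>S \<rightarrow> S\<close> with pointwise operations, of which \<^term>\<open>Der\<close> and
  \<^term>\<open>Der0 f\<close> are submodules.
\<close>

definition der_scale ::
  "'a::comm_ring_1 poly4 \<Rightarrow> ('a poly4 \<Rightarrow> 'a poly4) \<Rightarrow> ('a poly4 \<Rightarrow> 'a poly4)" where
  "der_scale c \<delta> = (\<lambda>p. c * \<delta> p)"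

interpretation der_module: module der_scale
  by unfold_locales (auto simp: der_scale_def fun_eq_iff algebra_simps)

section \<open>Free divisors\<close>

text \<open>
  Freeness of the divisor \<open>V(f)\<close> is a notion for reduced (that is, squarefree) homogeneous \<open>f\<close>;
  both requirements on \<open>f\<close> are part of the definition. The existential quantifier over the basis
  makes the order of the exponents irrelevant.
\<close>

definition free_divisor_with_exponents ::
  "'a::comm_ring_1 poly4 \<Rightarrow> nat \<Rightarrow> nat \<Rightarrow> nat \<Rightarrow> bool" where
  "free_divisor_with_exponents f a1 a2 a3 \<longleftrightarrow>
     squarefree f \<and> (\<exists>d. homogeneous d f) \<and>
     (\<exists>\<delta>1 \<delta>2 \<delta>3.
        distinct [\<delta>1, \<delta>2, \<delta>3] \<and>
        homogeneous_der a1 \<delta>1 \<and> homogeneous_der a2 \<delta>2 \<and> homogeneous_der a3 \<delta>3 \<and>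
        der_module.independent {\<delta>1, \<delta>2, \<delta>3} \<and>
        der_module.span {\<delta>1, \<delta>2, \<delta>3} = Der0 f)"

definition F_poly :: "'a::comm_ring_1 set \<Rightarrow> nat \<Rightarrow> nat \<Rightarrow> nat \<Rightarrow> 'a poly4" where
  "F_poly \<Lambda> r0 r1 r2 =
     (Var IX ^ r0 + Var IY ^ r1) *
     (\<Prod>\<alpha>\<in>\<Lambda>. Var IX ^ r0 + Var IY ^ r1 + Cst \<alpha> * Var IZ ^ r2)"

end

theory Submission
  imports Defs
begin

text \<open>
  Write \<open>G\<close> for the homogenization of \<open>x^r0 + y^r1\<close>, \<open>H \<alpha> = t^a G + \<alpha> B\<close> with \<open>B = t^b z^r2\<close> for that of
  the factor belonging to \<open>\<alpha>\<close>, \<open>P\<close> for the product of the \<open>H \<alpha>\<close>, and \<open>f = t G P\<close>. Modulo \<open>H \<alpha>\<close>, every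
  other \<open>H \<beta>\<close> is a non-zero multiple of the monomial \<open>B\<close>. Since the variables are prime elements and
  \<open>t\<close>, \<open>z\<close> divide neither \<open>G\<close> nor \<open>H \<alpha>\<close>, the factors of \<open>f\<close> can be cancelled against each other without
  unique factorization.

  The weighted Euler derivation \<open>\<theta>\<close> with weights \<open>1/r0, 1/r1, 1/r2, 0\<close> fixes \<open>G\<close>, and
  \<open>\<theta> f = (n + 1) f\<close> for \<open>n = |\<Lambda>|\<close>. The basis consists of \<open>\<delta>1\<close>, the difference of the Euler derivation and
  a multiple of \<open>\<theta>\<close>; the Hamiltonian derivation \<open>\<delta>2\<close> of \<open>G\<close> in \<open>x, y\<close>; and
  \<open>\<delta>3 = P \<partial>\<^sub>z - 1/(n + 1) P\<^sub>z \<theta>\<close>. Given \<open>\<delta>\<close> with \<open>\<delta> f = 0\<close>, a multiple of \<open>\<delta>1\<close> removes \<open>\<delta> t\<close>. Then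
  \<open>\<delta> G = u G\<close>, and every \<open>H \<alpha>\<close>, hence \<open>P\<close>, divides \<open>r2 \<delta> z - z u\<close>, so that a multiple of \<open>\<delta>3\<close> removes
  both \<open>\<delta> z\<close> and \<open>\<delta> G\<close>. What is left is a syzygy of the coprime monomials \<open>G\<^sub>x\<close> and \<open>G\<^sub>y\<close>.
\<close>

text \<open>The order on the variables only serves to make \<open>poly4\<close> an instance of class \<open>idom\<close>.\<close>

instantiation indet :: linorder
begin

fun indet_index :: "indet \<Rightarrow> nat" where
  "indet_index IX = 0" | "indet_index IY = 1" | "indet_index IZ = 2" | "indet_index IT = 3"

definition less_eq_indet :: "indet \<Rightarrow> indet \<Rightarrow> bool" where
  "less_eq_indet v w \<longleftrightarrow> indet_index v \<le> indet_index w"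

definition less_indet :: "indet \<Rightarrow> indet \<Rightarrow> bool" where
  "less_indet v w \<longleftrightarrow> indet_index v < indet_index w"

instance
proof
  fix v w :: indet
  show "v \<le> w \<Longrightarrow> w \<le> v \<Longrightarrow> v = w"
    by (cases v; cases w) (auto simp: less_eq_indet_def)
qed (auto simp: less_eq_indet_def less_indet_def)

end

section \<open>Polynomials in four variables\<close>

lemma Cst_0 [simp]: "Cst 0 = 0"
  and Cst_1 [simp]: "Cst 1 = 1"
  by (simp_all add: Cst_def)

lemma Cst_add: "Cst (a + b) = Cst a + Cst b"
  by (simp add: Cst_def single_add)

lemma Cst_mult: "Cst (a * b) = Cst a * Cst b"
  by (simp add: Cst_def mult_single)

lemma Cst_minus: "Cst (- a) = - Cst a"
  by (simp add: Cst_def single_uminus)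

lemma Cst_diff: "Cst (a - b) = Cst a - Cst b"
  by (simp add: Cst_def single_diff)

lemma Cst_of_nat: "Cst (of_nat n) = of_nat n"
  by (simp add: Cst_def)

lemma Cst_eq_0_iff [simp]: "Cst c = 0 \<longleftrightarrow> c = 0"
  by (metis Cst_def single_zero lookup_single_eq lookup_zero)

lemma Cst_dvd_1: "c \<noteq> 0 \<Longrightarrow> Cst c dvd (1 :: 'a::field poly4)"
  by (rule dvdI[of _ _ "Cst (inverse c)"]) (simp flip: Cst_mult)

lemma dvd_Cst_mult_iff:
  fixes h :: "'a::field poly4"
  assumes "c \<noteq> 0"
  shows "h dvd Cst c * w \<longleftrightarrow> h dvd w"
proof
  assume "h dvd Cst c * w"
  then have "h dvd Cst (inverse c) * (Cst c * w)"
    by (rule dvd_mult)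
  then show "h dvd w"
    using assms by (simp flip: Cst_mult mult.assoc)
qed (rule dvd_mult)

lemma Cst_mult_dvd_iff:
  fixes h :: "'a::field poly4"
  assumes "c \<noteq> 0"
  shows "Cst c * h dvd w \<longleftrightarrow> h dvd w"
proof
  assume "h dvd w"
  then have "Cst c * h dvd Cst c * w"
    by (rule mult_dvd_mono[OF dvd_refl])
  then show "Cst c * h dvd w"
    by (simp only: dvd_Cst_mult_iff[OF assms])
qed (rule dvd_mult_right)

lemma Var_power: "Var v ^ k = Poly_Mapping.single (Poly_Mapping.single v k) 1"
  by (induction k) (auto simp: Var_def mult_single simp flip: single_add)

lemma prod_single_one:
  "(\<Prod>v\<in>A. Poly_Mapping.single (g v) (1::'a::comm_ring_1)) = Poly_Mapping.single (\<Sum>v\<in>A. g v) 1"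
  by (induction A rule: infinite_finite_induct) (auto simp: mult_single)

lemma monom_eq_sum_single: "m = (\<Sum>v\<in>UNIV. Poly_Mapping.single v (Poly_Mapping.lookup m v))"
  for m :: monom4
  by (rule poly_mapping_eqI) (simp add: lookup_sum lookup_single when_def)

lemma single_eq_prod_Var:
  "Poly_Mapping.single m c = Cst c * (\<Prod>v\<in>UNIV. Var v ^ Poly_Mapping.lookup m v)"
  by (simp add: Var_power prod_single_one Cst_def mult_single flip: monom_eq_sum_single)

lemma poly4_eq_sum_single:
  "p = (\<Sum>m\<in>Poly_Mapping.keys p. Poly_Mapping.single m (Poly_Mapping.lookup p m))"
  by (rule poly_mapping_eqI)
    (auto simp: lookup_sum lookup_single when_def in_keys_iff)

lemma poly4_induct_single [case_names single add]:
  fixes p :: "'a::comm_ring_1 poly4"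
  assumes single: "\<And>m c. P (Poly_Mapping.single m c)"
    and add: "\<And>p q. P p \<Longrightarrow> P q \<Longrightarrow> P (p + q)"
  shows "P p"
proof -
  have "P (\<Sum>m\<in>A. Poly_Mapping.single m (Poly_Mapping.lookup p m))" for A
    by (induction A rule: infinite_finite_induct) (use single[of 0 0] in \<open>auto intro: single add\<close>)
  then show ?thesis
    using poly4_eq_sum_single[of p] by metis
qed

lemma poly4_induct [case_names Cst Var add mult]:
  fixes p :: "'a::comm_ring_1 poly4"
  assumes Cst: "\<And>c. P (Cst c)" and Var: "\<And>v. P (Var v)"
    and add: "\<And>p q. P p \<Longrightarrow> P q \<Longrightarrow> P (p + q)"
    and mult: "\<And>p q. P p \<Longrightarrow> P q \<Longrightarrow> P (p * q)"
  shows "P p"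
proof (induction p rule: poly4_induct_single)
  case (single m c)
  have 1: "P 1"
    using Cst[of 1] by simp
  have power: "P (Var v ^ k)" for v k
    by (induction k) (auto intro: 1 Var mult)
  have "P (\<Prod>v\<in>A. Var v ^ Poly_Mapping.lookup m v)" for A
    by (induction A rule: infinite_finite_induct) (auto intro: 1 mult power)
  then show ?case
    unfolding single_eq_prod_Var by (intro mult Cst)
qed (rule add)

section \<open>Substitution homomorphisms and the primality of the variables\<close>

definition subst :: "(indet \<Rightarrow> 'a::comm_ring_1 poly4) \<Rightarrow> 'a poly4 \<Rightarrow> 'a poly4" where
  "subst \<rho> p = (\<Sum>m\<in>Poly_Mapping.keys p.
     Cst (Poly_Mapping.lookup p m) * (\<Prod>v\<in>UNIV. \<rho> v ^ Poly_Mapping.lookup m v))"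

lemma subst_single:
  "subst \<rho> (Poly_Mapping.single m c) = Cst c * (\<Prod>v\<in>UNIV. \<rho> v ^ Poly_Mapping.lookup m v)"
  by (simp add: subst_def)

lemma subst_add [simp]: "subst \<rho> (p + q) = subst \<rho> p + subst \<rho> q"
  unfolding subst_def
  by (rule setsum_keys_plus_distrib) (auto simp: Cst_add algebra_simps)

lemma subst_mult [simp]: "subst \<rho> (p * q) = subst \<rho> p * subst \<rho> q"
proof (induction p rule: poly4_induct_single)
  case (single m c)
  show ?case
  proof (induction q rule: poly4_induct_single)
    case (single m' c')
    show ?case
      by (simp add: mult_single subst_single Cst_mult lookup_add power_add prod.distrib)
  qed (simp add: distrib_left)
qed (simp add: distrib_right)

lemma subst_Cst [simp]: "subst \<rho> (Cst c) = Cst c"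
  unfolding Cst_def subst_single by (simp add: Cst_def)

lemma subst_0 [simp]: "subst \<rho> 0 = 0"
  and subst_1 [simp]: "subst \<rho> 1 = 1"
  using subst_Cst[of \<rho> 0] subst_Cst[of \<rho> 1] by simp_all

lemma subst_Var [simp]: "subst \<rho> (Var v) = \<rho> v"
proof -
  have "(\<Prod>w\<in>UNIV. \<rho> w ^ Poly_Mapping.lookup (Poly_Mapping.single v 1) w) =
      (\<Prod>w\<in>UNIV. if w = v then \<rho> w else 1)"
    by (intro prod.cong) (auto simp: lookup_single)
  then show ?thesis
    by (simp add: Var_def subst_single)
qed

lemma subst_power [simp]: "subst \<rho> (p ^ k) = subst \<rho> p ^ k"
  by (induction k) auto

lemma subst_prod [simp]: "subst \<rho> (\<Prod>a\<in>A. g a) = (\<Prod>a\<in>A. subst \<rho> (g a))"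
  by (induction A rule: infinite_finite_induct) auto

text \<open>Congruence modulo a variable respects sums and products, so checking the generators is
  enough.\<close>

lemma Var_dvd_diff_subst:
  fixes p :: "'a::comm_ring_1 poly4"
  shows "Var v dvd p - subst (Var(v := 0)) p"
proof (induction p rule: poly4_induct)
  case (add p q)
  have "p + q - subst (Var(v := 0)) (p + q) =
      (p - subst (Var(v := 0)) p) + (q - subst (Var(v := 0)) q)"
    by simp
  then show ?case
    using add by (metis dvd_add)
next
  case (mult p q)
  have "p * q - subst (Var(v := 0)) (p * q) =
      (p - subst (Var(v := 0)) p) * q + subst (Var(v := 0)) p * (q - subst (Var(v := 0)) q)"
    by (simp add: algebra_simps)
  then show ?case
    using mult by (metis dvd_add dvd_mult dvd_mult2)
qed auto

lemma Var_dvd_iff: "Var v dvd p \<longleftrightarrow> subst (Var(v := 0)) p = 0"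
proof
  show "Var v dvd p \<Longrightarrow> subst (Var(v := 0)) p = 0"
    by (auto elim!: dvdE)
  show "subst (Var(v := 0)) p = 0 \<Longrightarrow> Var v dvd p"
    using Var_dvd_diff_subst[of v p] by simp
qed

lemma Var_neq_0 [simp]: "Var v \<noteq> (0 :: 'a::comm_ring_1 poly4)"
  using subst_Var[of "\<lambda>_. 1" v] by (metis subst_0 zero_neq_one)

text \<open>\<open>subst (Var(v := 0))\<close> is a homomorphism into an integral domain, and its
  kernel is the ideal of \<open>Var v\<close>.\<close>

lemma prime_elem_Var: "prime_elem (Var v :: 'a::idom poly4)"
proof (rule prime_elemI)
  show "\<not> Var v dvd (1 :: 'a poly4)"
    by (simp add: Var_dvd_iff)
  fix p q :: "'a poly4"
  assume "Var v dvd p * q"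
  then show "Var v dvd p \<or> Var v dvd q"
    by (simp add: Var_dvd_iff)
qed simp

lemma not_Var_dvd:
  assumes "\<rho> v = 0" "subst \<rho> p \<noteq> 0"
  shows "\<not> Var v dvd p"
  using assms by (auto elim!: dvdE)

text \<open>Replaces unique factorization: in \<open>p ^ Suc k * w = h * v\<close> the prime
  \<open>p\<close> must divide \<open>v\<close>, and one factor \<open>p\<close> cancels on both
  sides.\<close>

lemma dvd_mult_prime_cancel:
  fixes h :: "'a::idom"
  assumes p: "prime_elem p" "\<not> p dvd h" and h: "h dvd p ^ k * w"
  shows "h dvd w"
  using h
proof (induction k)
  case (Suc k)
  then obtain v where v: "p * (p ^ k * w) = h * v"
    by (auto elim!: dvdE simp: mult.assoc)
  then have "p dvd v"
    using p by (metis dvd_triv_left prime_elem_dvd_mult_iff)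
  then obtain v' where "v = p * v'" ..
  with v have "p * (p ^ k * w) = p * (h * v')"
    by (simp add: mult.left_commute)
  then have "p ^ k * w = h * v'"
    using p(1) by (metis mult_left_cancel prime_elem_not_zeroI)
  then show ?case
    using Suc.IH by simp
qed simp

section \<open>Derivations\<close>

lemma pdiff_single:
  "pdiff v (Poly_Mapping.single m c) =
     Poly_Mapping.single (m - Poly_Mapping.single v 1) (of_nat (Poly_Mapping.lookup m v) * c)"
  by (simp add: pdiff_def)

lemma pdiff_add: "pdiff v (p + q) = pdiff v p + pdiff v q"
  unfolding pdiff_def
  by (rule setsum_keys_plus_distrib) (auto simp: algebra_simps single_add)

lemma pdiff_mult_single:
  "pdiff v (Poly_Mapping.single m c * Poly_Mapping.single m' c') =
     Poly_Mapping.single m c * pdiff v (Poly_Mapping.single m' c') +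
     Poly_Mapping.single m' c' * pdiff v (Poly_Mapping.single m c)"
proof -
  let ?e = "Poly_Mapping.single v (1::nat)"
  have shift: "m + (m' - ?e) = m + m' - ?e" if "Poly_Mapping.lookup m' v > 0" for m m' :: monom4
    by (rule poly_mapping_eqI)
      (use that in \<open>auto simp: lookup_add lookup_minus lookup_single when_def\<close>)
  have comm: "m' + (m - ?e) = (m - ?e) + m'"
    by (simp add: add.commute)
  \<comment> \<open>If the exponent is 0, the subtraction truncates but the coefficient vanishes;
    \<open>shift\<close> covers the other case.\<close>
  have "Poly_Mapping.single (m + (m' - ?e)) (c * (of_nat (Poly_Mapping.lookup m' v) * c')) =
      Poly_Mapping.single (m + m' - ?e) (of_nat (Poly_Mapping.lookup m' v) * (c * c'))"
    by (cases "Poly_Mapping.lookup m' v") (simp_all add: shift[simplified] mult.left_commute)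
  moreover have "Poly_Mapping.single (m' + (m - ?e)) (c' * (of_nat (Poly_Mapping.lookup m v) * c)) =
      Poly_Mapping.single (m + m' - ?e) (of_nat (Poly_Mapping.lookup m v) * (c * c'))"
    by (cases "Poly_Mapping.lookup m v") (simp_all add: shift[simplified] mult_ac add.commute[of m])
  ultimately show ?thesis
    by (simp add: mult_single pdiff_single lookup_add algebra_simps flip: single_add)
qed

lemma pdiff_mult: "pdiff v (p * q) = p * pdiff v q + q * pdiff v p"
proof (induction p rule: poly4_induct_single)
  case (single m c)
  show ?case
  proof (induction q rule: poly4_induct_single)
    case (single m' c')
    show ?case
      by (rule pdiff_mult_single)
  qed (simp add: pdiff_add algebra_simps)
qed (simp add: pdiff_add algebra_simps)

lemma pdiff_Cst [simp]: "pdiff v (Cst c) = 0"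
  by (simp add: Cst_def pdiff_single)

lemma pdiff_Var: "pdiff v (Var w) = (if v = w then 1 else 0)"
  by (auto simp: Var_def pdiff_single lookup_single)

section \<open>Derivations and their eigenvectors\<close>

lemma DerI:
  assumes "\<And>p q. \<delta> (p + q) = \<delta> p + \<delta> q" "\<And>c. \<delta> (Cst c) = 0"
    "\<And>p q. \<delta> (p * q) = p * \<delta> q + q * \<delta> p"
  shows "\<delta> \<in> Der"
  using assms by (simp add: Der_def)

lemma pdiff_in_Der: "pdiff v \<in> Der"
  by (intro DerI pdiff_add pdiff_Cst pdiff_mult)

lemma
  assumes "\<delta> \<in> Der"
  shows Der_add: "\<delta> (p + q) = \<delta> p + \<delta> q"
    and Der_mult: "\<delta> (p * q) = p * \<delta> q + q * \<delta> p"
  using assms by (auto simp: Der_def)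

lemma Der_Cst:
  assumes "\<delta> \<in> Der"
  shows "\<delta> (Cst c) = 0"
proof -
  have "\<delta> 1 = 0"
    using Der_mult[OF assms, of 1 1] by simp
  moreover have "\<delta> (Cst c * 1) = Cst c * \<delta> 1"
    using assms unfolding Der_def by blast
  ultimately show ?thesis
    by simp
qed

lemma Der_sum_scale:
  assumes "\<And>i. i \<in> I \<Longrightarrow> \<delta> i \<in> Der"
  shows "(\<lambda>p. \<Sum>i\<in>I. c i * \<delta> i p) \<in> Der"
proof (intro DerI)
  fix p q
  have "(\<Sum>i\<in>I. c i * \<delta> i (p * q)) = (\<Sum>i\<in>I. p * (c i * \<delta> i q) + q * (c i * \<delta> i p))"
    using assms by (intro sum.cong) (auto simp: Der_mult algebra_simps)
  then show "(\<Sum>i\<in>I. c i * \<delta> i (p * q)) = p * (\<Sum>i\<in>I. c i * \<delta> i q) + q * (\<Sum>i\<in>I. c i * \<delta> i p)"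
    by (simp add: sum.distrib sum_distrib_left)
qed (use assms in \<open>simp_all add: Der_add Der_Cst algebra_simps sum.distrib\<close>)

definition der_of :: "(indet \<Rightarrow> 'a::comm_ring_1 poly4) \<Rightarrow> 'a poly4 \<Rightarrow> 'a poly4" where
  "der_of c p = (\<Sum>v\<in>UNIV. c v * pdiff v p)"

lemma der_of_in_Der [simp]: "der_of c \<in> Der"
  unfolding der_of_def by (intro Der_sum_scale pdiff_in_Der)

lemma der_of_Var [simp]: "der_of c (Var v) = c v"
  by (simp add: der_of_def pdiff_Var if_distrib cong: if_cong)

lemma Der_eqI:
  fixes \<delta> \<epsilon> :: "'a::comm_ring_1 poly4 \<Rightarrow> 'a poly4"
  assumes "\<delta> \<in> Der" "\<epsilon> \<in> Der" "\<And>v. \<delta> (Var v) = \<epsilon> (Var v)"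
  shows "\<delta> = \<epsilon>"
proof
  fix p
  show "\<delta> p = \<epsilon> p"
    using assms by (induction p rule: poly4_induct) (auto simp: Der_add Der_mult Der_Cst)
qed

lemma Der_eq_der_of: "\<delta> \<in> Der \<Longrightarrow> \<delta> = der_of (\<lambda>v. \<delta> (Var v))"
  by (intro Der_eqI) auto

text \<open>Eigenvalues may be arbitrary polynomials: they are logarithmic derivatives, hence
  additive over products.\<close>

lemma Der_eigen_mult:
  assumes "\<delta> \<in> Der" "\<delta> p = a * p" "\<delta> q = b * q"
  shows "\<delta> (p * q) = (a + b) * (p * q)"
  using assms by (simp add: Der_mult algebra_simps)

lemma Der_eigen_add:
  assumes "\<delta> \<in> Der" "\<delta> p = a * p" "\<delta> q = a * q"
  shows "\<delta> (p + q) = a * (p + q)"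
  using assms by (simp add: Der_add algebra_simps)

lemma Der_eigen_Cst_mult:
  assumes "\<delta> \<in> Der" "\<delta> p = a * p"
  shows "\<delta> (Cst c * p) = a * (Cst c * p)"
  using assms by (simp add: Der_mult Der_Cst algebra_simps)

lemma Der_eigen_prod:
  assumes "\<delta> \<in> Der" "\<And>i. i \<in> I \<Longrightarrow> \<delta> (g i) = a * g i" "finite I"
  shows "\<delta> (prod g I) = of_nat (card I) * a * prod g I"
  using assms(3,2)
proof (induction I rule: finite_induct)
  case empty
  show ?case using Der_Cst[OF assms(1), of 1] by simp
next
  case (insert i I)
  then show ?case
    using Der_eigen_mult[OF assms(1), of "g i" a "prod g I" "of_nat (card I) * a"]
    by (simp add: algebra_simps)
qed

lemma Der_eigen_power:
  assumes "\<delta> \<in> Der" "\<delta> p = a * p"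
  shows "\<delta> (p ^ k) = of_nat k * a * p ^ k"
  using Der_eigen_prod[OF assms(1), of "{..<k}" "\<lambda>_. p" a] assms(2) by simp

lemma Der_prod_const:
  assumes "\<delta> \<in> Der" "finite I" "\<And>i. i \<in> I \<Longrightarrow> \<delta> (g i) = v"
  shows "\<delta> (prod g I) = v * (\<Sum>i\<in>I. prod g (I - {i}))"
  using assms(2,3)
proof (induction I rule: finite_induct)
  case empty
  show ?case using Der_Cst[OF assms(1), of 1] by simp
next
  case (insert i I)
  have "prod g (insert i I - {j}) = g i * prod g (I - {j})" if "j \<in> I" for j
    using insert.hyps that by (subst insert_Diff_if) auto
  then show ?case
    using insert by (simp add: Der_mult[OF assms(1)] algebra_simps sum_distrib_left)
qed

lemma Der_diff_scale:
  assumes "\<delta> \<in> Der" "\<epsilon> \<in> Der"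
  shows "(\<lambda>p. \<delta> p - k * \<epsilon> p) \<in> Der"
  using assms by (auto intro!: DerI simp: Der_add Der_mult Der_Cst algebra_simps)

lemma Der_power_Suc:
  assumes "\<delta> \<in> Der"
  shows "\<delta> (p ^ Suc k) = of_nat (Suc k) * p ^ k * \<delta> p"
  by (induction k) (auto simp: Der_mult[OF assms] algebra_simps)

lemma Der0_subspace: "der_module.subspace (Der0 f)"
proof (rule der_module.subspaceI)
  show "0 \<in> Der0 f"
    by (auto simp: Der0_def intro!: DerI)
next
  fix \<delta> \<epsilon> assume "\<delta> \<in> Der0 f" "\<epsilon> \<in> Der0 f"
  then show "\<delta> + \<epsilon> \<in> Der0 f"
    by (auto simp: Der0_def Der_add Der_mult Der_Cst algebra_simps intro!: DerI)
next
  fix c \<delta> assume "\<delta> \<in> Der0 f"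
  then show "der_scale c \<delta> \<in> Der0 f"
    by (auto simp: Der0_def der_scale_def Der_add Der_mult Der_Cst algebra_simps intro!: DerI)
qed

section \<open>Homogeneous polynomials\<close>

lemma mon_degree_add: "mon_degree (m + m') = mon_degree m + mon_degree m'"
  by (simp add: mon_degree_def lookup_add sum.distrib)

lemma mon_degree_single: "mon_degree (Poly_Mapping.single v k) = k"
  by (simp add: mon_degree_def lookup_single when_def)

lemma homogeneous_0 [simp]: "homogeneous d 0"
  by (simp add: homogeneous_def)

lemma homogeneous_Cst [simp]: "homogeneous 0 (Cst c)"
  by (auto simp: homogeneous_def Cst_def mon_degree_def)

lemma homogeneous_1 [simp]: "homogeneous 0 1"
  using homogeneous_Cst[of 1] by simp

lemma homogeneous_Var [simp]: "homogeneous 1 (Var v)"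
  by (simp add: homogeneous_def Var_def mon_degree_single)

lemma homogeneous_add: "homogeneous d p \<Longrightarrow> homogeneous d q \<Longrightarrow> homogeneous d (p + q)"
  using keys_add[of p q] by (auto simp: homogeneous_def)

lemma homogeneous_mult: "homogeneous d p \<Longrightarrow> homogeneous e q \<Longrightarrow> homogeneous (d + e) (p * q)"
  using keys_mult[of p q] by (fastforce simp: homogeneous_def mon_degree_add)

lemma homogeneous_Cst_mult: "homogeneous d p \<Longrightarrow> homogeneous d (Cst c * p)"
  using homogeneous_mult[OF homogeneous_Cst] by fastforce

lemma homogeneous_uminus: "homogeneous d p \<Longrightarrow> homogeneous d (- p)"
  using homogeneous_Cst_mult[of d p "- 1"] by (simp add: Cst_minus)

lemma homogeneous_diff: "homogeneous d p \<Longrightarrow> homogeneous d q \<Longrightarrow> homogeneous d (p - q)"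
  using homogeneous_add[OF _ homogeneous_uminus] by fastforce

lemma homogeneous_prod:
  assumes "finite I" "\<And>i. i \<in> I \<Longrightarrow> homogeneous d (g i)"
  shows "homogeneous (card I * d) (prod g I)"
  using assms by (induction I rule: finite_induct) (auto intro: homogeneous_mult)

lemma homogeneous_power: "homogeneous d p \<Longrightarrow> homogeneous (k * d) (p ^ k)"
  using homogeneous_prod[of "{..<k}" d "\<lambda>_. p"] by simp

lemma keys_pdiff:
  assumes "m \<in> Poly_Mapping.keys (pdiff v p)"
  shows "m + Poly_Mapping.single v 1 \<in> Poly_Mapping.keys p"
proof -
  let ?e = "Poly_Mapping.single v (1::nat)"
  obtain m' where m': "m' \<in> Poly_Mapping.keys p"
    "m \<in> Poly_Mapping.keys (Poly_Mapping.single (m' - ?e)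
      (of_nat (Poly_Mapping.lookup m' v) * Poly_Mapping.lookup p m'))"
    using assms keys_sum unfolding pdiff_def by fast
  then have "m = m' - ?e" "Poly_Mapping.lookup m' v \<noteq> 0"
    by (auto split: if_splits intro: Nat.gr0I)
  then have "m + ?e = m'"
    by (intro poly_mapping_eqI) (auto simp: lookup_add lookup_minus lookup_single when_def)
  then show ?thesis
    using m' by simp
qed

lemma homogeneous_pdiff: "homogeneous (Suc d) p \<Longrightarrow> homogeneous d (pdiff v p)"
  by (fastforce simp: homogeneous_def mon_degree_add mon_degree_single dest: keys_pdiff)

text \<open>The variable restores the degree lost in differentiation, so \<open>d = 0\<close> is
  allowed; \<open>P\<close> has degree 0 when \<Lambda> is empty.\<close>

lemma homogeneous_Var_mult_pdiff:
  assumes "homogeneous d p"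
  shows "homogeneous d (Var w * pdiff v p)"
proof (cases d)
  case 0
  then have "Poly_Mapping.keys (pdiff v p) = {}"
    using assms
    by (fastforce simp: homogeneous_def mon_degree_add mon_degree_single dest: keys_pdiff)
  then show ?thesis
    by simp
next
  case (Suc d')
  then show ?thesis
    using homogeneous_mult[OF homogeneous_Var homogeneous_pdiff] assms by fastforce
qed

lemma homogeneous_der_der_of:
  "(\<And>v. homogeneous a (c v)) \<Longrightarrow> homogeneous_der a (der_of c)"
  by (auto simp: homogeneous_der_def der_of_def)

text \<open>Setting \<open>t = 1\<close> only forgets the exponent of \<open>t\<close>, which the
  common degree \<open>d\<close> recovers. Non-divisibility by \<open>t\<close> keeps the total
  degree at \<open>d\<close>.\<close>

lemma homogenize_subst_IT_1:
  fixes p :: "'a::comm_ring_1 poly4"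
  assumes p: "homogeneous d p" and not_dvd: "\<not> Var IT dvd p"
  shows "homogenize (subst (Var(IT := 1)) p) = p"
proof -
  define drop :: "monom4 \<Rightarrow> monom4" where
    "drop m = m - Poly_Mapping.single IT (Poly_Mapping.lookup m IT)" for m
  have split: "m = drop m + Poly_Mapping.single IT (Poly_Mapping.lookup m IT)" for m
    by (rule poly_mapping_eqI) (auto simp: drop_def lookup_add lookup_minus lookup_single when_def)
  have subst_mon: "subst (Var(IT := 1)) (Poly_Mapping.single m c) = Poly_Mapping.single (drop m) c"
    for m and c :: 'a
  proof -
    have "(\<Prod>v\<in>UNIV. (Var(IT := 1)) v ^ Poly_Mapping.lookup m v) =
        (\<Prod>v\<in>UNIV. (Var v :: 'a poly4) ^ Poly_Mapping.lookup (drop m) v)"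
      by (intro prod.cong) (auto simp: drop_def lookup_minus lookup_single)
    then show ?thesis
      unfolding subst_single single_eq_prod_Var[of "drop m"] by simp
  qed
  have deg: "mon_degree m = d" if "m \<in> Poly_Mapping.keys p" for m
    using p that by (simp add: homogeneous_def)
  have deg_drop: "mon_degree (drop m) + Poly_Mapping.lookup m IT = d"
    if "m \<in> Poly_Mapping.keys p" for m
    using deg[OF that] split[of m] by (metis mon_degree_add mon_degree_single)
  have inj: "inj_on drop (Poly_Mapping.keys p)"
  proof (rule inj_onI)
    fix m m' assume "m \<in> Poly_Mapping.keys p" "m' \<in> Poly_Mapping.keys p" "drop m = drop m'"
    then show "m = m'"
      using deg_drop split by (metis add_left_cancel)
  qed
  let ?q = "subst (Var(IT := 1)) p"
  have q: "?q = (\<Sum>m\<in>Poly_Mapping.keys p. Poly_Mapping.single (drop m) (Poly_Mapping.lookup p m))"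
    using subst_mon unfolding subst_def[of _ p] subst_single by simp
  have lookup_q: "Poly_Mapping.lookup ?q (drop m) = Poly_Mapping.lookup p m"
    if "m \<in> Poly_Mapping.keys p" for m
  proof -
    have "Poly_Mapping.lookup ?q (drop m) =
        (\<Sum>m'\<in>Poly_Mapping.keys p. if m' = m then Poly_Mapping.lookup p m' else 0)"
      unfolding q lookup_sum lookup_single
      using inj that by (intro sum.cong) (auto simp: when_def inj_on_def)
    then show ?thesis
      using that by simp
  qed
  have keys_q: "Poly_Mapping.keys ?q = drop ` Poly_Mapping.keys p"
  proof
    show "Poly_Mapping.keys ?q \<subseteq> drop ` Poly_Mapping.keys p"
      unfolding q using keys_sum by (fastforce split: if_splits)
    show "drop ` Poly_Mapping.keys p \<subseteq> Poly_Mapping.keys ?q"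
      by (auto simp: in_keys_iff lookup_q)
  qed
  \<comment> \<open>Otherwise every monomial would vanish at \<open>t = 0\<close>. This one keeps
    its degree \<open>d\<close> when \<open>t\<close> is set to 1.\<close>
  obtain m0 where m0: "m0 \<in> Poly_Mapping.keys p" "Poly_Mapping.lookup m0 IT = 0"
  proof (rule ccontr)
    assume "\<not> thesis"
    then have "Poly_Mapping.lookup m IT > 0" if "m \<in> Poly_Mapping.keys p" for m
      using that \<open>\<And>m. \<lbrakk>m \<in> Poly_Mapping.keys p; Poly_Mapping.lookup m IT = 0\<rbrakk> \<Longrightarrow> thesis\<close>
      by blast
    then have "subst (Var(IT := 0)) p = 0"
      unfolding subst_def by (intro sum.neutral ballI) (simp add: UNIV_indet zero_power)
    then show False
      using not_dvd by (simp add: Var_dvd_iff)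
  qed
  have "total_degree ?q = d"
    unfolding total_degree_def keys_q
  proof (rule Max_eqI)
    show "d \<in> insert 0 (mon_degree ` drop ` Poly_Mapping.keys p)"
      using m0 deg_drop by force
  qed (use deg_drop in \<open>auto, fastforce\<close>)
  then have "homogenize ?q = (\<Sum>m\<in>Poly_Mapping.keys p.
      Poly_Mapping.single (drop m + Poly_Mapping.single IT (d - mon_degree (drop m)))
        (Poly_Mapping.lookup p m))"
    unfolding homogenize_def keys_q using inj by (simp add: sum.reindex lookup_q)
  also have "\<dots> = (\<Sum>m\<in>Poly_Mapping.keys p. Poly_Mapping.single m (Poly_Mapping.lookup p m))"
  proof (rule sum.cong)
    fix m assume "m \<in> Poly_Mapping.keys p"
    then have "d - mon_degree (drop m) = Poly_Mapping.lookup m IT"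
      using deg_drop by fastforce
    then show "Poly_Mapping.single (drop m + Poly_Mapping.single IT (d - mon_degree (drop m)))
        (Poly_Mapping.lookup p m) = Poly_Mapping.single m (Poly_Mapping.lookup p m)"
      using split[of m] by simp
  qed simp
  also have "\<dots> = p"
    by (rule poly4_eq_sum_single[symmetric])
  finally show ?thesis .
qed

section \<open>Coprimality and squarefreeness\<close>

locale arrangement =
  fixes \<Lambda> :: "'a::field_char_0 set" and r0 r1 r2 :: nat
  assumes fin: "finite \<Lambda>" and zero_notin: "0 \<notin> \<Lambda>"
    and r0_pos: "r0 > 0" and r1_pos: "r1 > 0" and r2_pos: "r2 > 0"
begin

abbreviation X :: "'a poly4" where "X \<equiv> Var IX"
abbreviation Y :: "'a poly4" where "Y \<equiv> Var IY"
abbreviation Z :: "'a poly4" where "Z \<equiv> Var IZ"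
abbreviation T :: "'a poly4" where "T \<equiv> Var IT"

definition m :: nat where "m = max r0 r1"
definition M :: nat where "M = max r0 (max r1 r2)"
definition G :: "'a poly4" where "G = T ^ (m - r0) * X ^ r0 + T ^ (m - r1) * Y ^ r1"
definition B :: "'a poly4" where "B = T ^ (M - r2) * Z ^ r2"
definition H :: "'a \<Rightarrow> 'a poly4" where "H \<alpha> = T ^ (M - m) * G + Cst \<alpha> * B"
definition P :: "'a poly4" where "P = (\<Prod>\<alpha>\<in>\<Lambda>. H \<alpha>)"
definition f :: "'a poly4" where "f = T * (G * P)"

lemma le_m: "r0 \<le> m" "r1 \<le> m" and le_M: "m \<le> M" "r2 \<le> M"
  by (auto simp: m_def M_def)

text \<open>Up to a power of \<open>t\<close>, \<open>G\<close> is the member \<alpha> = 0 of the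
  family, so results on pairs of members also relate \<open>G\<close> to \<open>P\<close>.\<close>

lemma H_0: "H 0 = T ^ (M - m) * G"
  by (simp add: H_def)

text \<open>The point (1, 0, 0, 1), where all factors of \<open>f\<close> take the value 1; hence
  neither \<open>y\<close> nor \<open>z\<close> divides any of \<open>G\<close>,
  \<open>H \<alpha>\<close>, \<open>f\<close>.\<close>

definition pt_xt :: "indet \<Rightarrow> 'a poly4" where
  "pt_xt v = (if v = IX \<or> v = IT then 1 else 0)"

lemma subst_pt_xt: "subst pt_xt G = 1" "subst pt_xt (H \<alpha>) = 1" "subst pt_xt P = 1"
  "subst pt_xt f = 1"
proof -
  show G: "subst pt_xt G = 1"
    using r1_pos by (simp add: G_def pt_xt_def)
  show "subst pt_xt (H \<alpha>) = 1" for \<alpha>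
    using r2_pos by (simp add: H_def G B_def) (simp add: pt_xt_def)
  then show P: "subst pt_xt P = 1"
    by (simp add: P_def)
  show "subst pt_xt f = 1"
    by (simp add: f_def G P) (simp add: pt_xt_def)
qed

lemma not_YZ_dvd:
  assumes "v \<in> {IY, IZ}"
  shows "\<not> Var v dvd G" "\<not> Var v dvd H \<alpha>" "\<not> Var v dvd f"
proof -
  have v: "pt_xt v = 0"
    using assms by (auto simp: pt_xt_def)
  then show "\<not> Var v dvd G" "\<not> Var v dvd H \<alpha>" "\<not> Var v dvd f"
    using not_Var_dvd[where \<rho> = pt_xt, OF v] by (simp_all add: subst_pt_xt)
qed

lemma nonzero: "G \<noteq> 0" "H \<alpha> \<noteq> 0" "P \<noteq> 0" "f \<noteq> 0"
  using subst_pt_xt(1,3) subst_pt_xt(2)[of \<alpha>] subst_pt_xt(4) by auto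

text \<open>A summand with maximal exponent carries no \<open>t\<close> and is 1 at a coordinate
  point where the other summand vanishes.\<close>

lemma not_T_dvd_G: "\<not> T dvd G"
proof (cases "r0 \<le> r1")
  case True
  then have "subst (\<lambda>v. if v = IY then 1 else 0) G = 1"
    using r0_pos by (simp add: G_def m_def)
  then show ?thesis
    by (intro not_Var_dvd[of "\<lambda>v. if v = IY then 1 else 0"]) auto
next
  case False
  then have "subst (\<lambda>v. if v = IX then 1 else 0) G = 1"
    using r1_pos by (simp add: G_def m_def)
  then show ?thesis
    by (intro not_Var_dvd[of "\<lambda>v. if v = IX then 1 else 0"]) auto
qed

text \<open>If \<open>r2 \<le> m\<close>, no power of \<open>t\<close> stands before
  \<open>G\<close>, and \<open>z = 0\<close> leaves \<open>G\<close>. Otherwise \<open>B\<close> is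
  a pure power of \<open>z\<close>, and the coordinate point of \<open>z\<close> leaves
  \<alpha>.\<close>

lemma not_T_dvd_H:
  assumes "\<alpha> \<noteq> 0"
  shows "\<not> T dvd H \<alpha>"
proof (cases "r2 \<le> m")
  case True
  then have "M = m"
    by (auto simp: m_def M_def)
  have "\<not> T dvd subst (Var(IZ := 0)) (H \<alpha>)"
  proof -
    have "subst (Var(IZ := 0)) G = G"
      by (simp add: G_def)
    then have "subst (Var(IZ := 0)) (H \<alpha>) = G"
      using \<open>M = m\<close> r2_pos by (simp add: H_def B_def)
    then show ?thesis
      using not_T_dvd_G by simp
  qed
  then show ?thesis
    by (auto elim!: dvdE)
next
  case False
  then have "M = r2" "M - m > 0"
    by (auto simp: m_def M_def)
  then have "subst (\<lambda>v. if v = IZ then 1 else 0) (H \<alpha>) = Cst \<alpha>"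
    by (simp add: H_def B_def)
  then show ?thesis
    using assms by (intro not_Var_dvd[of "\<lambda>v. if v = IZ then 1 else 0"]) auto
qed

lemma not_T_dvd_P: "\<not> T dvd P"
proof -
  have "\<not> T dvd prod H L" if "finite L" "0 \<notin> L" for L
    using that
  proof (induction L rule: finite_induct)
    case empty
    then show ?case
      by (simp add: Var_dvd_iff)
  next
    case (insert \<alpha> L)
    then show ?case
      using not_T_dvd_H[of \<alpha>] by (simp add: prime_elem_dvd_mult_iff[OF prime_elem_Var])
  qed
  then show ?thesis
    unfolding P_def using fin zero_notin by blast
qed

lemma not_T_dvd_GP: "\<not> T dvd G * P"
  using not_T_dvd_G not_T_dvd_P by (simp add: prime_elem_dvd_mult_iff[OF prime_elem_Var])

section \<open>Cancelling the factors against each other\<close>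

lemma dvd_B_power_cancel:
  assumes "\<not> T dvd h" "\<not> Z dvd h" "h dvd B ^ k * w"
  shows "h dvd w"
proof -
  have "h dvd T ^ ((M - r2) * k) * (Z ^ (r2 * k) * w)"
    using assms(3) by (simp add: B_def power_mult_distrib mult.assoc flip: power_mult)
  then show ?thesis
    using dvd_mult_prime_cancel[OF prime_elem_Var assms(1)]
      dvd_mult_prime_cancel[OF prime_elem_Var assms(2)] by blast
qed

text \<open>\<open>H \<beta>\<close> and \<open>H \<alpha>\<close> differ by \<beta> - \<alpha>
  times \<open>B\<close>; the constant is the product of these differences, nonzero because
  \<open>\<alpha> \<notin> L\<close>.\<close>

lemma prod_H_mod_H:
  assumes "finite L" "\<alpha> \<notin> L"
  obtains c s where "c \<noteq> 0" "prod H L = Cst c * B ^ card L + H \<alpha> * s"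
proof -
  have "\<exists>c s. c \<noteq> 0 \<and> prod H L = Cst c * B ^ card L + H \<alpha> * s"
    using assms
  proof (induction L rule: finite_induct)
    case empty
    show ?case
      by (intro exI[of _ 1] exI[of _ 0]) simp
  next
    case (insert \<beta> L)
    then obtain c s where c: "c \<noteq> 0" "prod H L = Cst c * B ^ card L + H \<alpha> * s"
      by auto
    have \<beta>: "H \<beta> = H \<alpha> + Cst (\<beta> - \<alpha>) * B"
      by (simp add: H_def Cst_diff algebra_simps)
    have "prod H (insert \<beta> L) = Cst ((\<beta> - \<alpha>) * c) * B ^ card (insert \<beta> L) +
        H \<alpha> * (prod H L + Cst (\<beta> - \<alpha>) * B * s)"
      using insert.hyps by (simp add: \<beta> c(2) Cst_mult) (simp add: algebra_simps)
    then show ?case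
      using c(1) insert.prems by (metis insertI1 mult_eq_0_iff right_minus_eq)
  qed
  then show ?thesis
    using that by blast
qed

text \<open>Modulo \<open>h\<close> the product is a unit times a power of \<open>B\<close>, which
  cancels. A divisor \<open>h\<close> of \<open>H \<alpha>\<close> is allowed in order to cover
  \<open>h = G\<close> with \<alpha> = 0.\<close>

lemma dvd_prod_H_cancel:
  assumes h: "\<not> T dvd h" "\<not> Z dvd h" "h dvd H \<alpha>"
    and L: "finite L" "\<alpha> \<notin> L" and dvd: "h dvd prod H L * w"
  shows "h dvd w"
proof -
  obtain c s where c: "c \<noteq> 0" "prod H L = Cst c * B ^ card L + H \<alpha> * s"
    using prod_H_mod_H[OF L] .
  have "Cst (inverse c) * Cst c = 1"
    using c(1) by (simp flip: Cst_mult)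
  then have "B ^ card L * w = Cst (inverse c) * Cst c * (B ^ card L * w)"
    by simp
  also have "\<dots> = Cst (inverse c) * (prod H L * w - H \<alpha> * (s * w))"
    unfolding c(2) by (simp only: algebra_simps)
  also have "h dvd \<dots>"
    by (rule dvd_mult, rule dvd_diff[OF dvd dvd_mult2[OF h(3)]])
  finally show ?thesis
    using dvd_B_power_cancel[OF h(1,2)] by blast
qed

lemma G_dvd_P_mult_cancel:
  assumes "G dvd P * w"
  shows "G dvd w"
proof (rule dvd_prod_H_cancel)
  show "G dvd H 0" "G dvd prod H \<Lambda> * w"
    using assms by (simp_all add: H_0 P_def)
qed (use fin zero_notin not_T_dvd_G not_YZ_dvd(1)[of IZ] in auto)

lemma H_dvd_prod_cancel:
  assumes "\<alpha> \<in> \<Lambda>" "L \<subseteq> \<Lambda>" "\<alpha> \<notin> L" "H \<alpha> dvd prod H L * w"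
  shows "H \<alpha> dvd w"
proof (rule dvd_prod_H_cancel)
  show "\<not> T dvd H \<alpha>"
    using assms(1) zero_notin by (intro not_T_dvd_H) auto
qed (use assms fin not_YZ_dvd(2)[of IZ] finite_subset in auto)

text \<open>The factors are absorbed one at a time: in \<open>w = prod H L * v\<close> the next
  \<open>H \<alpha>\<close> cancels against \<open>prod H L\<close> and so divides
  \<open>v\<close>.\<close>

lemma P_dvd:
  assumes "\<And>\<alpha>. \<alpha> \<in> \<Lambda> \<Longrightarrow> H \<alpha> dvd w"
  shows "P dvd w"
proof -
  have "prod H L dvd w" if "finite L" "L \<subseteq> \<Lambda>" for L
    using that
  proof (induction L rule: finite_induct)
    case (insert \<alpha> L)
    then obtain v where v: "w = prod H L * v"
      by (auto elim: dvdE)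
    then have "H \<alpha> dvd v"
      using insert assms H_dvd_prod_cancel[of \<alpha> L v] by auto
    then show ?case
      using insert.hyps v by (simp add: mult.commute[of "H \<alpha>"])
  qed simp
  then show ?thesis
    unfolding P_def using fin by blast
qed

text \<open>Expresses that the cofactors share only factors of \<open>B\<close>. Adding \<gamma>
  multiplies every old cofactor by \<open>H \<gamma>\<close>, so the induction hypothesis is used
  with \<open>u * (H \<gamma>)\<^sup>2\<close>; the new cofactor \<open>prod H L\<close> is a unit
  times a power of \<open>B\<close> modulo \<open>H \<gamma>\<close>.\<close>

lemma dvd_B_power_if_dvd_prods:
  assumes "finite L" "L \<noteq> {}" "\<And>\<alpha>. \<alpha> \<in> L \<Longrightarrow> q dvd u * (prod H (L - {\<alpha>}))\<^sup>2"
  shows "\<exists>N. q dvd u * B ^ N"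
  using assms
proof (induction L arbitrary: u rule: finite_ne_induct)
  case (singleton \<alpha>)
  then have "q dvd u * B ^ 0"
    by simp
  then show ?case ..
next
  case (insert \<gamma> L)
  have "q dvd (u * (H \<gamma>)\<^sup>2) * (prod H (L - {\<alpha>}))\<^sup>2" if "\<alpha> \<in> L" for \<alpha>
  proof -
    have "prod H (insert \<gamma> L - {\<alpha>}) = H \<gamma> * prod H (L - {\<alpha>})"
      using insert.hyps that by (subst insert_Diff_if) auto
    then show ?thesis
      using insert.prems[of \<alpha>] that by (simp add: power_mult_distrib mult.assoc)
  qed
  then obtain N where N: "q dvd u * (H \<gamma>)\<^sup>2 * B ^ N"
    using insert.IH by blast
  have "q dvd u * (prod H L)\<^sup>2"
    using insert.prems[of \<gamma>] insert.hyps by simp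
  obtain c s where c: "c \<noteq> 0" "prod H L = Cst c * B ^ card L + H \<gamma> * s"
    using prod_H_mod_H[of L \<gamma>] insert.hyps by blast
  define e where "e = Cst c * B ^ card L"
  \<comment> \<open>multiply \<open>(prod H L)\<^sup>2 = (e + H \<gamma> * s)\<^sup>2\<close> by its conjugate to get \<open>e^4\<close> modulo \<open>(H \<gamma>)\<^sup>2\<close>\<close>
  have "u * e ^ 4 * B ^ N = (u * (prod H L)\<^sup>2) * ((e - H \<gamma> * s)\<^sup>2 * B ^ N) +
      (u * (H \<gamma>)\<^sup>2 * B ^ N) * (s\<^sup>2 * (2 * e\<^sup>2 - (H \<gamma>)\<^sup>2 * s\<^sup>2))"
    unfolding c(2) e_def[symmetric] by algebra
  also have "q dvd \<dots>"
    using \<open>q dvd u * (prod H L)\<^sup>2\<close> N by (rule dvd_add[OF dvd_mult2 dvd_mult2])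
  finally have "q dvd u * e ^ 4 * B ^ N" .
  moreover have e4': "e ^ 4 = Cst c ^ 4 * B ^ (4 * card L)"
    by (simp add: e_def power_mult_distrib mult.commute flip: power_mult)
  ultimately have "q dvd Cst (inverse c) ^ 4 * (u * e ^ 4 * B ^ N)"
    by (blast intro: dvd_mult)
  also have "\<dots> = (Cst (inverse c) * Cst c) ^ 4 * (u * B ^ (4 * card L + N))"
    by (simp add: e4' power_add mult_ac power_mult_distrib)
  also have "Cst (inverse c) * Cst c = 1"
    using c(1) by (simp flip: Cst_mult)
  finally show ?case
    by auto
qed

section \<open>Partial derivatives of the factors and squarefreeness\<close>

lemma pdiff_G:
  "pdiff IX G = Cst (of_nat r0) * (T ^ (m - r0) * X ^ (r0 - 1))"
  "pdiff IY G = Cst (of_nat r1) * (T ^ (m - r1) * Y ^ (r1 - 1))"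
  "pdiff IZ G = 0"
proof -
  have pw: "pdiff v (Var w ^ k) = (if v = w then of_nat k * Var w ^ (k - 1) else 0)"
    for v w k
  proof (cases k)
    case (Suc k')
    then show ?thesis
      using Der_power_Suc[OF pdiff_in_Der, of v "Var w" k'] by (auto simp: pdiff_Var simp del: power_Suc)
  next
    case 0
    then show ?thesis
      using pdiff_Cst[of v 1] by (auto simp del: pdiff_Cst)
  qed
  show "pdiff IX G = Cst (of_nat r0) * (T ^ (m - r0) * X ^ (r0 - 1))"
    "pdiff IY G = Cst (of_nat r1) * (T ^ (m - r1) * Y ^ (r1 - 1))" "pdiff IZ G = 0"
    using r0_pos r1_pos by (simp_all add: G_def pdiff_add pdiff_mult pw Cst_of_nat mult_ac)
qed

text \<open>\<open>B\<close> does not involve \<open>y\<close>, so the derivative is the same for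
  all \<alpha>.\<close>

lemma pdiff_Y_H: "pdiff IY (H \<alpha>) = T ^ (M - m) * pdiff IY G"
proof -
  have T: "pdiff IY (T ^ k) = 0" and Z: "pdiff IY (Z ^ k) = 0" for k
    using Der_eigen_power[OF pdiff_in_Der, of IY T 0 k] Der_eigen_power[OF pdiff_in_Der, of IY Z 0 k]
    by (simp_all add: pdiff_Var)
  show ?thesis
    by (simp add: H_def B_def pdiff_add pdiff_mult T Z)
qed

text \<open>
  If \<open>q\<^sup>2\<close> divides \<open>f\<close>, then \<open>q\<close> divides \<open>\<partial>\<^sub>y\<close> of \<open>t^(M - m) f = t \<Prod> H \<alpha>\<close>, where \<open>\<alpha>\<close> now ranges over
  \<open>\<Lambda> \<union> {0}\<close>. All \<open>H \<alpha>\<close> have the same \<open>y\<close>-derivative, so multiplying by one of the cofactors shows that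
  \<open>q\<close> divides a monomial times the square of each cofactor. By \<open>dvd_B_power_if_dvd_prods\<close>, \<open>q\<close> then
  divides a monomial in \<open>t, y, z\<close>, none of which divides \<open>q\<close>.
\<close>

lemma squarefree_f: "squarefree f"
proof (rule squarefreeI)
  fix q assume q2: "q\<^sup>2 dvd f"
  define L where "L = insert 0 \<Lambda>"
  define \<Phi> where "\<Phi> = prod H L"
  define V where "V = T ^ (M - m) * pdiff IY G"
  have L: "finite L"
    using fin by (simp add: L_def)
  obtain s where s: "f = q\<^sup>2 * s"
    using q2 ..
  define r where "r = T ^ (M - m) * s"
  have "T * \<Phi> = T ^ (M - m) * f"
    using fin zero_notin by (simp add: \<Phi>_def L_def H_0 f_def P_def mult_ac)
  then have r: "T * \<Phi> = q * (q * r)"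
    by (simp add: r_def s power2_eq_square mult_ac)
  have "pdiff IY (T * \<Phi>) = T * V * (\<Sum>\<beta>\<in>L. prod H (L - {\<beta>}))"
    unfolding pdiff_mult \<Phi>_def
    by (subst Der_prod_const[OF pdiff_in_Der L, of IY H V])
      (simp_all add: pdiff_Y_H V_def pdiff_Var)
  moreover have "q dvd pdiff IY (T * \<Phi>)"
    unfolding r by (subst pdiff_mult) (auto simp: pdiff_mult)
  ultimately have q_sum: "q dvd T * V * (\<Sum>\<beta>\<in>L. prod H (L - {\<beta>}))"
    by simp
  have q_Q: "q dvd T * V * (prod H (L - {\<alpha>}))\<^sup>2" if "\<alpha> \<in> L" for \<alpha>
  proof -
    let ?Q = "\<lambda>\<beta>. prod H (L - {\<beta>})"
    \<comment> \<open>For \<beta> \<noteq> \<alpha> the cofactor of \<beta> contains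
      \<open>H \<alpha>\<close>, so the product of both cofactors is a multiple of \<Phi>.\<close>
    have "q dvd T * V * (?Q \<beta> * ?Q \<alpha>)" if "\<beta> \<in> L - {\<alpha>}" for \<beta>
    proof -
      have "?Q \<beta> = H \<alpha> * prod H (L - {\<beta>} - {\<alpha>})"
        using that \<open>\<alpha> \<in> L\<close> L by (intro prod.remove) auto
      moreover have "\<Phi> = H \<alpha> * ?Q \<alpha>"
        unfolding \<Phi>_def using \<open>\<alpha> \<in> L\<close> L by (intro prod.remove) auto
      ultimately have eq: "T * V * (?Q \<beta> * ?Q \<alpha>) = T * \<Phi> * (V * prod H (L - {\<beta>} - {\<alpha>}))"
        by (simp add: mult_ac)
      show ?thesis
        unfolding eq r by (simp add: mult.assoc)
    qed
    then have rest: "q dvd (\<Sum>\<beta>\<in>L - {\<alpha>}. T * V * (?Q \<beta> * ?Q \<alpha>))"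
      by (rule dvd_sum)
    have "T * V * (\<Sum>\<beta>\<in>L. ?Q \<beta>) * ?Q \<alpha> = (\<Sum>\<beta>\<in>L. T * V * (?Q \<beta> * ?Q \<alpha>))"
      by (simp add: sum_distrib_left sum_distrib_right mult_ac)
    also have "\<dots> = T * V * (?Q \<alpha>)\<^sup>2 + (\<Sum>\<beta>\<in>L - {\<alpha>}. T * V * (?Q \<beta> * ?Q \<alpha>))"
      using L that by (subst sum.remove[of L \<alpha>]) (simp_all add: power2_eq_square)
    finally have "q dvd T * V * (?Q \<alpha>)\<^sup>2 + (\<Sum>\<beta>\<in>L - {\<alpha>}. T * V * (?Q \<beta> * ?Q \<alpha>))"
      using dvd_mult2[OF q_sum, of "?Q \<alpha>"] by (simp only:)
    then show ?thesis
      using rest by (simp only: dvd_add_left_iff)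
  qed
  have "L \<noteq> {}"
    by (simp add: L_def)
  then obtain N where "q dvd T * V * B ^ N"
    using dvd_B_power_if_dvd_prods[OF L _ q_Q] by blast
  also have "T * V * B ^ N = T ^ (1 + (M - m) + (m - r1) + (M - r2) * N) *
      (Y ^ (r1 - 1) * (Z ^ (r2 * N) * Cst (of_nat r1)))"
    by (simp add: V_def pdiff_G B_def power_mult_distrib power_add mult_ac flip: power_mult)
  finally have q_dvd: "q dvd \<dots>" .
  \<comment> \<open>\<open>f\<close> contains \<open>t\<close> exactly once, whereas
    \<open>t\<close> dividing \<open>q\<close> would put \<open>t\<^sup>2\<close> into
    \<open>f\<close>.\<close>
  have T: "\<not> T dvd q"
  proof
    assume "T dvd q"
    then have "T * T dvd T * (G * P)"
      using dvd_trans[OF mult_dvd_mono q2[unfolded power2_eq_square]] by (simp only: f_def)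
    then show False
      using not_T_dvd_GP by simp
  qed
  have "q dvd f"
    using s by (simp add: power2_eq_square mult.assoc)
  then have Y: "\<not> Y dvd q" and Z: "\<not> Z dvd q"
    using dvd_trans[of _ q f] not_YZ_dvd(3)[of IY] not_YZ_dvd(3)[of IZ] by auto
  note cancel = dvd_mult_prime_cancel[OF prime_elem_Var]
  have "q dvd Cst (of_nat r1)"
    by (rule cancel[OF Z cancel[OF Y cancel[OF T q_dvd]]])
  also have "Cst (of_nat r1) dvd (1 :: 'a poly4)"
    using r1_pos by (intro Cst_dvd_1) auto
  finally show "q dvd 1" .
qed

end

section \<open>The basis of logarithmic derivations\<close>

context arrangement
begin

abbreviation n :: nat where "n \<equiv> card \<Lambda>"

text \<open>The condition on \<open>B\<close> gives both summands of \<open>H \<alpha>\<close> the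
  same eigenvalue, independent of \<alpha>.\<close>

lemma Der_H_eigen:
  assumes \<delta>: "\<delta> \<in> Der" and T: "\<delta> T = t * T" and G: "\<delta> G = g * G"
    and B: "\<delta> B = (g + of_nat (M - m) * t) * B"
  shows "\<delta> (H \<alpha>) = (g + of_nat (M - m) * t) * H \<alpha>"
  unfolding H_def
  using Der_eigen_mult[OF \<delta> Der_eigen_power[OF \<delta> T] G] Der_eigen_Cst_mult[OF \<delta> B]
  by (intro Der_eigen_add[OF \<delta>]) (simp_all add: add.commute)

lemma Der_GP_eigen:
  assumes \<delta>: "\<delta> \<in> Der" and T: "\<delta> T = t * T" and G: "\<delta> G = g * G"
    and B: "\<delta> B = (g + of_nat (M - m) * t) * B"
  shows "\<delta> (G * P) = (g + of_nat n * (g + of_nat (M - m) * t)) * (G * P)"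
  unfolding P_def
  using assms fin by (intro Der_eigen_mult Der_eigen_prod Der_H_eigen)

lemma Der_f_eigen:
  assumes \<delta>: "\<delta> \<in> Der" and T: "\<delta> T = t * T" and G: "\<delta> G = g * G"
    and B: "\<delta> B = (g + of_nat (M - m) * t) * B"
  shows "\<delta> f = (t + (g + of_nat n * (g + of_nat (M - m) * t))) * f"
  unfolding f_def using assms by (intro Der_eigen_mult Der_GP_eigen)

definition diag :: "(indet \<Rightarrow> 'a) \<Rightarrow> 'a poly4 \<Rightarrow> 'a poly4" where
  "diag w = der_of (\<lambda>v. Cst (w v) * Var v)"

lemma diag_in_Der: "diag w \<in> Der"
  and diag_Var: "diag w (Var v) = Cst (w v) * Var v"
  by (simp_all add: diag_def)

lemma diag_mult_powers:
  "diag w (Var v ^ i * Var v' ^ j) =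
     Cst (of_nat i * w v + of_nat j * w v') * (Var v ^ i * Var v' ^ j)"
  using Der_eigen_mult[OF diag_in_Der Der_eigen_power[OF diag_in_Der diag_Var[of w v], of i]
      Der_eigen_power[OF diag_in_Der diag_Var[of w v'], of j]]
  by (simp add: Cst_add Cst_mult Cst_of_nat)

lemma diag_G:
  assumes "of_nat (m - r0) * w IT + of_nat r0 * w IX = g"
    and "of_nat (m - r1) * w IT + of_nat r1 * w IY = g"
  shows "diag w G = Cst g * G"
  unfolding G_def
  by (intro Der_eigen_add diag_in_Der) (simp_all add: diag_mult_powers assms)

lemma diag_B: "diag w B = Cst (of_nat (M - r2) * w IT + of_nat r2 * w IZ) * B"
  unfolding B_def by (rule diag_mult_powers)

definition weight :: "indet \<Rightarrow> 'a" where
  "weight v = (case v of IX \<Rightarrow> 1 / of_nat r0 | IY \<Rightarrow> 1 / of_nat r1 | IZ \<Rightarrow> 1 / of_nat r2 | IT \<Rightarrow> 0)"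

definition \<theta> :: "'a poly4 \<Rightarrow> 'a poly4" where
  "\<theta> = diag weight"

text \<open>\<open>G\<close> and all \<open>H \<alpha>\<close> have eigenvalue 1 and
  \<open>t\<close> has eigenvalue 0, so the eigenvalue of \<open>f\<close> counts the
  \<open>n + 1\<close> factors other than \<open>t\<close>.\<close>

lemma \<theta>_eigen: "\<theta> G = G" "\<theta> f = Cst (of_nat (Suc n)) * f"
proof -
  have G: "\<theta> G = 1 * G" and B: "\<theta> B = 1 * B" and T: "\<theta> T = 0 * T"
    unfolding \<theta>_def using r0_pos r1_pos r2_pos
    by (simp_all add: diag_G[of _ 1] diag_B diag_Var weight_def)
  show "\<theta> G = G"
    using G by simp
  show "\<theta> f = Cst (of_nat (Suc n)) * f"
    using Der_f_eigen[OF _ T G] B diag_in_Der[of weight] by (simp add: \<theta>_def Cst_add Cst_of_nat)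
qed

text \<open>Chosen such that \<open>c1 \<theta>\<close> and the Euler derivation agree on \<open>f\<close>.\<close>

definition c1 :: 'a where
  "c1 = of_nat (1 + m + n * M) / of_nat (Suc n)"

definition \<delta>1 :: "'a poly4 \<Rightarrow> 'a poly4" where
  "\<delta>1 = diag (\<lambda>v. 1 - c1 * weight v)"

definition \<delta>2 :: "'a poly4 \<Rightarrow> 'a poly4" where
  "\<delta>2 = der_of (\<lambda>v. case v of IX \<Rightarrow> pdiff IY G | IY \<Rightarrow> - pdiff IX G | _ \<Rightarrow> 0)"

definition \<delta>3 :: "'a poly4 \<Rightarrow> 'a poly4" where
  "\<delta>3 = der_of (\<lambda>v. (if v = IZ then P else 0) -
     Cst (1 / of_nat (Suc n)) * (Cst (weight v) * (Var v * pdiff IZ P)))"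

lemma \<delta>3_eq: "\<delta>3 p = P * pdiff IZ p - Cst (1 / of_nat (Suc n)) * pdiff IZ P * \<theta> p"
proof -
  have "\<delta>3 p = (\<Sum>v\<in>UNIV. (if v = IZ then P * pdiff v p else 0) -
      Cst (1 / of_nat (Suc n)) * pdiff IZ P * (Cst (weight v) * Var v * pdiff v p))"
    unfolding \<delta>3_def der_of_def by (intro sum.cong refl) (simp add: algebra_simps)
  then show ?thesis
    by (simp add: sum_subtractf \<theta>_def diag_def der_of_def sum_distrib_left)
qed

lemma \<delta>_in_Der: "\<delta>1 \<in> Der" "\<delta>2 \<in> Der" "\<delta>3 \<in> Der"
  by (simp_all add: \<delta>1_def \<delta>2_def \<delta>3_def diag_in_Der)

text \<open>The eigenvalues are 1 on \<open>t\<close>, \<open>m - c1\<close> on \<open>G\<close> and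
  \<open>M - c1\<close> on each \<open>H \<alpha>\<close>; their total is the degree of
  \<open>f\<close> minus \<open>(n + 1) * c1\<close>, which is 0.\<close>

lemma \<delta>1_f: "\<delta>1 f = 0"
proof -
  have le: "of_nat (a - b) = (of_nat a - of_nat b :: 'a)" if "b \<le> a" for a b
    using that by (rule of_nat_diff)
  have T: "\<delta>1 T = Cst 1 * T"
    by (simp add: \<delta>1_def diag_Var weight_def)
  have G: "\<delta>1 G = Cst (of_nat m - c1) * G"
    unfolding \<delta>1_def using r0_pos r1_pos
    by (intro diag_G) (simp_all add: weight_def le le_m field_simps)
  have "of_nat (M - r2) * (1 - c1 * weight IT) + of_nat r2 * (1 - c1 * weight IZ) = of_nat M - c1"
    using r2_pos by (simp add: weight_def le le_M field_simps)
  then have "\<delta>1 B = Cst (of_nat M - c1) * B"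
    unfolding \<delta>1_def diag_B by simp
  also have "of_nat M - c1 = of_nat m - c1 + of_nat (M - m) * 1"
    by (simp add: le le_M)
  finally have B: "\<delta>1 B = (Cst (of_nat m - c1) + of_nat (M - m) * Cst 1) * B"
    unfolding Cst_add by (simp add: Cst_of_nat)
  have "1 + (of_nat m - c1 + of_nat n * (of_nat m - c1 + of_nat (M - m) * 1)) =
      of_nat (1 + m + n * M) - of_nat (Suc n) * c1"
    by (simp add: le le_M algebra_simps)
  also have "\<dots> = 0"
    by (simp add: c1_def del: of_nat_Suc)
  finally have "Cst 1 + (Cst (of_nat m - c1) +
      of_nat n * (Cst (of_nat m - c1) + of_nat (M - m) * Cst 1)) = (0 :: 'a poly4)"
    by (metis Cst_0 Cst_add Cst_mult Cst_of_nat)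
  then show ?thesis
    using Der_f_eigen[OF \<delta>_in_Der(1) T G B] by simp
qed

lemma \<delta>2_G: "\<delta>2 G = 0"
  by (simp add: \<delta>2_def der_of_def UNIV_indet)

lemma \<delta>2_f: "\<delta>2 f = 0"
proof -
  have T: "\<delta>2 T = 0 * T" and Z: "\<delta>2 Z = 0 * Z"
    by (simp_all add: \<delta>2_def)
  have "\<delta>2 B = 0"
    unfolding B_def using Der_eigen_mult[OF \<delta>_in_Der(2) Der_eigen_power[OF \<delta>_in_Der(2) T]
        Der_eigen_power[OF \<delta>_in_Der(2) Z]] by simp
  then show ?thesis
    using Der_f_eigen[OF \<delta>_in_Der(2) T, of 0] \<delta>2_G by simp
qed

text \<open>Among the factors of \<open>f\<close> only \<open>P\<close> involves \<open>z\<close>,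
  so \<open>P * pdiff IZ f = f * pdiff IZ P\<close>, which the \<theta> term cancels.\<close>

lemma \<delta>3_f: "\<delta>3 f = 0"
proof -
  have f_Z: "pdiff IZ f = T * (G * pdiff IZ P)"
    by (simp add: f_def pdiff_mult pdiff_G pdiff_Var)
  have inv: "Cst (1 / of_nat (Suc n)) * Cst (of_nat (Suc n)) = (1 :: 'a poly4)"
    by (simp flip: Cst_mult del: of_nat_Suc)
  have "Cst (1 / of_nat (Suc n)) * pdiff IZ P * \<theta> f =
      Cst (1 / of_nat (Suc n)) * Cst (of_nat (Suc n)) * (pdiff IZ P * f)"
    unfolding \<theta>_eigen(2) by (simp only: mult_ac)
  then have \<theta>_f: "Cst (1 / of_nat (Suc n)) * pdiff IZ P * \<theta> f = pdiff IZ P * f"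
    unfolding inv by simp
  show ?thesis
    unfolding \<delta>3_eq f_Z \<theta>_f by (simp add: f_def mult_ac)
qed

section \<open>Degrees of the factors and of the basis\<close>

lemma homogeneous_G: "homogeneous m G"
proof -
  have "homogeneous (((m - k) * 1) + k * 1) (T ^ (m - k) * Var v ^ k)" for k v
    by (intro homogeneous_mult homogeneous_power homogeneous_Var)
  then have "homogeneous m (T ^ (m - k) * Var v ^ k)" if "k \<le> m" for k v
    using that by (metis le_add_diff_inverse2 mult.right_neutral)
  then show ?thesis
    unfolding G_def using le_m by (intro homogeneous_add)
qed

lemma homogeneous_H: "homogeneous M (H \<alpha>)"
proof -
  have "homogeneous ((M - m) * 1 + m) (T ^ (M - m) * G)"
    by (intro homogeneous_mult homogeneous_power homogeneous_Var homogeneous_G)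
  moreover have "homogeneous ((M - r2) * 1 + r2 * 1) B"
    unfolding B_def by (intro homogeneous_mult homogeneous_power homogeneous_Var)
  ultimately show ?thesis
    unfolding H_def using le_M by (intro homogeneous_add homogeneous_Cst_mult) simp_all
qed

lemma homogeneous_P: "homogeneous (n * M) P"
  unfolding P_def using fin homogeneous_H by (rule homogeneous_prod)

lemma homogeneous_GP: "homogeneous (m + n * M) (G * P)"
  by (intro homogeneous_mult homogeneous_G homogeneous_P)

lemma homogeneous_\<delta>:
  "homogeneous_der 1 \<delta>1" "homogeneous_der (m - 1) \<delta>2" "homogeneous_der (n * M) \<delta>3"
proof -
  show "homogeneous_der 1 \<delta>1"
    unfolding \<delta>1_def diag_def
    by (intro homogeneous_der_der_of homogeneous_Cst_mult homogeneous_Var)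
  \<comment> \<open>\<open>m \<ge> 1\<close> because \<open>r0 > 0\<close>, so \<open>m - 1\<close>
    does not truncate.\<close>
  have "homogeneous (Suc (m - 1)) G"
    using homogeneous_G r0_pos by (simp add: m_def)
  then have "homogeneous (m - 1) (pdiff v G)" for v
    by (rule homogeneous_pdiff)
  then show "homogeneous_der (m - 1) \<delta>2"
    unfolding \<delta>2_def
    by (intro homogeneous_der_der_of) (auto split: indet.split intro: homogeneous_uminus)
  show "homogeneous_der (n * M) \<delta>3"
    unfolding \<delta>3_def using homogeneous_P
    by (intro homogeneous_der_der_of homogeneous_diff homogeneous_Cst_mult
        homogeneous_Var_mult_pdiff) auto
qed

section \<open>Linear independence\<close>

lemma \<delta>_Var:
  "\<delta>1 T = T" "\<delta>2 T = 0" "\<delta>3 T = 0" "\<delta>2 Z = 0" "\<delta>2 X = pdiff IY G" "\<delta>2 Y = - pdiff IX G"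
  by (simp_all add: \<delta>1_def \<delta>2_def \<delta>3_def diag_Var weight_def)

lemma \<delta>3_Z: "\<delta>3 Z = P - Cst (1 / of_nat (Suc n)) * (Cst (1 / of_nat r2) * (Z * pdiff IZ P))"
  by (simp add: \<delta>3_def weight_def)

text \<open>Otherwise \<open>z\<close> would divide \<open>P\<close>, but \<open>P\<close> is 1 at
  \<open>pt_xt\<close>, where \<open>z = 0\<close>.\<close>

lemma \<delta>3_Z_nonzero: "\<delta>3 Z \<noteq> 0"
proof
  assume "\<delta>3 Z = 0"
  then have "P = Cst (1 / of_nat (Suc n)) * (Cst (1 / of_nat r2) * (Z * pdiff IZ P))"
    unfolding \<delta>3_Z by (simp only: right_minus_eq)
  moreover have "Z dvd \<dots>"
    by (intro dvd_mult dvd_triv_left)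
  ultimately have "Z dvd P"
    by (simp only:)
  moreover have "pt_xt IZ = 0"
    by (simp add: pt_xt_def)
  ultimately show False
    using not_Var_dvd[of pt_xt IZ P] subst_pt_xt(3) by simp
qed

lemma pdiff_G_nonzero: "pdiff IX G \<noteq> 0" "pdiff IY G \<noteq> 0"
  using r0_pos r1_pos by (simp_all add: pdiff_G)

lemma distinct_\<delta>: "distinct [\<delta>1, \<delta>2, \<delta>3]"
  using \<delta>_Var \<delta>3_Z_nonzero Var_neq_0[of IT] by (auto dest: fun_cong)

lemma independent_\<delta>: "der_module.independent {\<delta>1, \<delta>2, \<delta>3}"
proof
  assume "der_module.dependent {\<delta>1, \<delta>2, \<delta>3}"
  then obtain u where u: "\<exists>\<delta>\<in>{\<delta>1, \<delta>2, \<delta>3}. u \<delta> \<noteq> 0"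
    "(\<Sum>\<delta>\<in>{\<delta>1, \<delta>2, \<delta>3}. der_scale (u \<delta>) \<delta>) = 0"
    by (subst (asm) der_module.dependent_finite) auto
  have eq: "u \<delta>1 * \<delta>1 p + (u \<delta>2 * \<delta>2 p + u \<delta>3 * \<delta>3 p) = 0" for p
    using fun_cong[OF u(2), of p] distinct_\<delta> by (simp add: der_scale_def)
  \<comment> \<open>The values at \<open>t\<close>, \<open>z\<close>, \<open>x\<close> form a
    triangular system: only \<open>\<delta>1\<close> is nonzero at \<open>t\<close>, and
    \<open>\<delta>2\<close> vanishes at \<open>z\<close>.\<close>
  have u1: "u \<delta>1 = 0"
    using eq[of T] by (simp add: \<delta>_Var)
  have u3: "u \<delta>3 = 0"
    using eq[of Z] \<delta>3_Z_nonzero by (simp add: \<delta>_Var u1)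
  have u2: "u \<delta>2 = 0"
    using eq[of X] pdiff_G_nonzero by (simp add: \<delta>_Var u1 u3)
  show False
    using u(1) u1 u2 u3 by auto
qed

section \<open>Generation of the module\<close>

lemma T_dvd_Der_T:
  assumes "\<delta> \<in> Der" "\<delta> f = 0"
  shows "T dvd \<delta> T"
proof -
  have "T * \<delta> (G * P) + G * P * \<delta> T = 0"
    using assms by (simp add: f_def Der_mult[OF assms(1), of T])
  then have "T dvd G * P * \<delta> T"
    by (metis add_eq_0_iff dvd_minus_iff dvd_triv_left)
  then show ?thesis
    using not_T_dvd_GP prime_elem_dvd_mult_iff[OF prime_elem_Var] by blast
qed

lemma Der_kills_T_G_Z:
  assumes \<delta>: "\<delta> \<in> Der" and T: "\<delta> T = 0" and G: "\<delta> G = 0" and Z: "\<delta> Z = 0"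
  obtains k where "\<And>p. \<delta> p = k * \<delta>2 p"
proof -
  have syz: "\<delta> X * pdiff IX G + \<delta> Y * pdiff IY G = 0"
  proof -
    have "\<delta> G = (\<Sum>v\<in>UNIV. \<delta> (Var v) * pdiff v G)"
      by (subst Der_eq_der_of[OF \<delta>]) (simp add: der_of_def)
    then show ?thesis
      by (simp add: UNIV_indet G T Z)
  qed
  have "\<exists>k. \<delta> X = k * pdiff IY G \<and> \<delta> Y = k * - pdiff IX G"
  \<comment> \<open>The split selects a partial derivative of \<open>G\<close> that is free of
    \<open>t\<close>. Up to a constant it is a power of one variable, so it cancels against the
    other partial derivative and divides the opposite coefficient.\<close>
  proof (cases "r1 \<le> r0")
    case True
    then have Gx: "pdiff IX G = Cst (of_nat r0) * X ^ (r0 - 1)"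
      by (simp add: pdiff_G m_def)
    have "pdiff IX G dvd \<delta> Y * pdiff IY G"
      using syz by (metis add.commute add_eq_0_iff dvd_minus_iff dvd_triv_right)
    also have "\<delta> Y * pdiff IY G = T ^ (m - r1) * (Y ^ (r1 - 1) * (Cst (of_nat r1) * \<delta> Y))"
      by (simp add: pdiff_G mult_ac)
    finally have dvd: "X ^ (r0 - 1) dvd \<dots>"
      using r0_pos by (simp add: Gx Cst_mult_dvd_iff)
    have "\<not> T dvd X ^ (r0 - 1)" "\<not> Y dvd X ^ (r0 - 1)"
      by (simp_all add: Var_dvd_iff)
    then have "X ^ (r0 - 1) dvd Cst (of_nat r1) * \<delta> Y"
      using dvd dvd_mult_prime_cancel[OF prime_elem_Var] by metis
    then have "pdiff IX G dvd \<delta> Y"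
      using r0_pos r1_pos by (simp add: Gx Cst_mult_dvd_iff dvd_Cst_mult_iff)
    then obtain k where k: "\<delta> Y = pdiff IX G * k" ..
    then have "pdiff IX G * (\<delta> X + k * pdiff IY G) = 0"
      using syz by (simp add: algebra_simps)
    then have "\<delta> X = - k * pdiff IY G"
      using pdiff_G_nonzero by (simp add: eq_neg_iff_add_eq_0)
    then show ?thesis
      using k by (intro exI[of _ "- k"]) simp
  next
    case False
    then have Gy: "pdiff IY G = Cst (of_nat r1) * Y ^ (r1 - 1)"
      by (simp add: pdiff_G m_def)
    have "pdiff IY G dvd \<delta> X * pdiff IX G"
      using syz by (metis add_eq_0_iff dvd_minus_iff dvd_triv_right)
    also have "\<delta> X * pdiff IX G = T ^ (m - r0) * (X ^ (r0 - 1) * (Cst (of_nat r0) * \<delta> X))"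
      by (simp add: pdiff_G mult_ac)
    finally have dvd: "Y ^ (r1 - 1) dvd \<dots>"
      using r1_pos by (simp add: Gy Cst_mult_dvd_iff)
    have "\<not> T dvd Y ^ (r1 - 1)" "\<not> X dvd Y ^ (r1 - 1)"
      by (simp_all add: Var_dvd_iff)
    then have "Y ^ (r1 - 1) dvd Cst (of_nat r0) * \<delta> X"
      using dvd dvd_mult_prime_cancel[OF prime_elem_Var] by metis
    then have "pdiff IY G dvd \<delta> X"
      using r0_pos r1_pos by (simp add: Gy Cst_mult_dvd_iff dvd_Cst_mult_iff)
    then obtain k where k: "\<delta> X = pdiff IY G * k" ..
    then have "pdiff IY G * (\<delta> Y + k * pdiff IX G) = 0"
      using syz by (simp add: algebra_simps)
    then have "\<delta> Y = - (k * pdiff IX G)"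
      using pdiff_G_nonzero by (simp add: eq_neg_iff_add_eq_0)
    then show ?thesis
      using k by (intro exI[of _ k]) simp
  qed
  then obtain k where k: "\<delta> X = k * pdiff IY G" "\<delta> Y = k * - pdiff IX G"
    by blast
  have "\<delta> = (\<lambda>p. k * \<delta>2 p)"
  proof (rule Der_eqI[OF \<delta>])
    show "(\<lambda>p. k * \<delta>2 p) \<in> Der"
      by (intro DerI) (simp_all add: Der_add[OF \<delta>_in_Der(2)] Der_mult[OF \<delta>_in_Der(2)]
          Der_Cst[OF \<delta>_in_Der(2)] algebra_simps)
    show "\<delta> (Var v) = k * \<delta>2 (Var v)" for v
      using k T Z by (cases v) (simp_all add: \<delta>_Var)
  qed
  then show ?thesis
    using that by metis
qed

text \<open>Finds the coefficient of \<open>\<delta>3\<close>. After subtraction, \<open>t\<close>,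
  \<open>G\<close> and \<open>z\<close> are eigenvectors governed by a single \<open>u'\<close>, and
  vanishing on \<open>f\<close> forces \<open>u' = 0\<close>.\<close>

lemma Der_kills_T_decompose:
  assumes \<delta>: "\<delta> \<in> Der" and T: "\<delta> T = 0" and f: "\<delta> f = 0"
  obtains k where "\<delta> G = k * \<delta>3 G" "\<delta> Z = k * \<delta>3 Z"
proof -
  let ?inv = "\<lambda>i. Cst (1 / of_nat i) :: 'a poly4"
  have "T * \<delta> (G * P) = 0"
    using f T unfolding f_def by (subst (asm) Der_mult[OF \<delta>]) simp
  then have GP: "G * \<delta> P + P * \<delta> G = 0"
    by (simp add: Der_mult[OF \<delta>])
  then have "G dvd P * \<delta> G"
    by (metis add_eq_0_iff dvd_minus_iff dvd_triv_left)
  then obtain u where u: "\<delta> G = G * u"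
    using G_dvd_P_mult_cancel by (blast elim: dvdE)
  then have "G * (\<delta> P + P * u) = 0"
    using GP by (simp add: algebra_simps)
  then have \<delta>P: "\<delta> P = - (P * u)"
    using nonzero(1) by (simp add: eq_neg_iff_add_eq_0)
  have T_pow: "\<delta> (T ^ k) = 0" for k
    using Der_eigen_power[OF \<delta>, of T 0 k] T by simp
  have \<delta>B: "\<delta> B = T ^ (M - r2) * Z ^ (r2 - 1) * (Cst (of_nat r2) * \<delta> Z)"
  proof -
    have "\<delta> (Z ^ r2) = of_nat r2 * Z ^ (r2 - 1) * \<delta> Z"
      using Der_power_Suc[OF \<delta>, of Z "r2 - 1"] r2_pos by (simp del: power_Suc of_nat_Suc)
    then show ?thesis
      by (simp add: B_def Der_mult[OF \<delta>] T_pow Cst_of_nat mult_ac)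
  qed
  have B_u: "\<delta> B - B * u = T ^ (M - r2) * (Z ^ (r2 - 1) * (Cst (of_nat r2) * \<delta> Z - Z * u))"
  proof -
    have "Z ^ r2 = Z ^ (r2 - 1) * Z"
      using r2_pos by (metis power_minus_mult)
    then have "B = T ^ (M - r2) * (Z ^ (r2 - 1) * Z)"
      by (simp only: B_def)
    then have "B * u = T ^ (M - r2) * (Z ^ (r2 - 1) * (Z * u))"
      by (simp only: mult.assoc)
    note Bu = this
    show ?thesis
      unfolding \<delta>B Bu by (simp only: algebra_simps)
  qed
  have "H \<alpha> dvd Cst (of_nat r2) * \<delta> Z - Z * u" if "\<alpha> \<in> \<Lambda>" for \<alpha>
  proof -
    have "\<alpha> \<noteq> 0"
      using that zero_notin by auto
    let ?Q = "prod H (\<Lambda> - {\<alpha>})"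
    have P: "P = H \<alpha> * ?Q"
      unfolding P_def using fin that by (rule prod.remove)
    have "H \<alpha> * \<delta> ?Q + ?Q * \<delta> (H \<alpha>) = - (H \<alpha> * ?Q * u)"
      using \<delta>P unfolding P Der_mult[OF \<delta>] .
    then have "?Q * \<delta> (H \<alpha>) = H \<alpha> * (- (?Q * u) - \<delta> ?Q)"
      by algebra
    then have "H \<alpha> dvd ?Q * \<delta> (H \<alpha>)"
      by simp
    then have "H \<alpha> dvd \<delta> (H \<alpha>)"
      by (rule H_dvd_prod_cancel[of \<alpha> "\<Lambda> - {\<alpha>}", rotated -1]) (use that in auto)
    \<comment> \<open>Modulo \<open>H \<alpha>\<close>, \<open>T ^ (M - m) * G\<close> is -\<alpha>
      times \<open>B\<close>, which turns \<open>\<delta> G = G * u\<close> into the term in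
      \<open>B * u\<close>.\<close>
    also have "\<delta> (H \<alpha>) = H \<alpha> * u + Cst \<alpha> * (\<delta> B - B * u)"
      by (simp add: H_def Der_add[OF \<delta>] Der_mult[OF \<delta>] Der_Cst[OF \<delta>] T_pow u algebra_simps)
    finally have "H \<alpha> dvd \<delta> B - B * u"
      by (simp only: dvd_add_right_iff[OF dvd_triv_left] dvd_Cst_mult_iff[OF \<open>\<alpha> \<noteq> 0\<close>])
    then have "H \<alpha> dvd Z ^ (r2 - 1) * (Cst (of_nat r2) * \<delta> Z - Z * u)"
      unfolding B_u by (rule dvd_mult_prime_cancel[OF prime_elem_Var not_T_dvd_H[OF \<open>\<alpha> \<noteq> 0\<close>]])
    then show ?thesis
      by (rule dvd_mult_prime_cancel[OF prime_elem_Var not_YZ_dvd(2), rotated]) simp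
  qed
  then obtain h where h: "Cst (of_nat r2) * \<delta> Z - Z * u = P * h"
    using P_dvd by (blast elim: dvdE)
  \<comment> \<open>Makes the \<open>P\<close> term of \<open>k * \<delta>3 Z\<close> match the
    \<open>P * h\<close> part of \<open>\<delta> Z\<close>; the rest is a multiple of
    \<open>z\<close>.\<close>
  define k where "k = ?inv r2 * h"
  \<comment> \<open>The eigenvalue of \<open>G\<close> after the subtraction: \<open>u\<close>
    corrected by the \<theta> part of \<open>\<delta>3\<close>.\<close>
  define u' where "u' = u + ?inv (Suc n) * (k * pdiff IZ P)"
  have inv: "?inv r2 * Cst (of_nat r2) = 1"
    using r2_pos by (simp flip: Cst_mult)
  have \<delta>Z: "\<delta> Z = k * P + ?inv r2 * (Z * u)"
  proof -
    have "\<delta> Z = ?inv r2 * (Cst (of_nat r2) * \<delta> Z)"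
      by (simp add: inv flip: mult.assoc)
    also have "Cst (of_nat r2) * \<delta> Z = P * h + Z * u"
      using h by (simp only: diff_eq_eq)
    finally show ?thesis
      by (simp add: k_def algebra_simps)
  qed
  define \<epsilon> where "\<epsilon> = (\<lambda>p. \<delta> p - k * \<delta>3 p)"
  have \<epsilon>: "\<epsilon> \<in> Der"
    unfolding \<epsilon>_def using \<delta> \<delta>_in_Der(3) by (rule Der_diff_scale)
  have \<epsilon>T: "\<epsilon> T = 0 * T"
    by (simp add: \<epsilon>_def T \<delta>_Var)
  have \<epsilon>G: "\<epsilon> G = u' * G"
    by (simp add: \<epsilon>_def u \<delta>3_eq pdiff_G(3) \<theta>_eigen u'_def algebra_simps)
  have \<epsilon>Z: "\<epsilon> Z = (?inv r2 * u') * Z"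
    unfolding \<epsilon>_def \<delta>Z \<delta>3_Z u'_def by (simp only: algebra_simps)
  have "\<epsilon> B = (of_nat (M - r2) * 0 + of_nat r2 * (?inv r2 * u')) * B"
    unfolding B_def by (intro Der_eigen_mult[OF \<epsilon>] Der_eigen_power[OF \<epsilon>] \<epsilon>T \<epsilon>Z)
  also have "of_nat r2 * (?inv r2 * u') = u'"
  proof -
    have "of_nat r2 * (?inv r2 * u') = ?inv r2 * Cst (of_nat r2) * u'"
      by (simp only: Cst_of_nat mult_ac)
    then show ?thesis
      by (simp add: inv)
  qed
  finally have "\<epsilon> B = (u' + of_nat (M - m) * 0) * B"
    by simp
  then have "\<epsilon> f = (0 + (u' + of_nat n * (u' + of_nat (M - m) * 0))) * f"
    by (intro Der_f_eigen[OF \<epsilon> \<epsilon>T \<epsilon>G])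
  also have "\<dots> = Cst (of_nat (Suc n)) * u' * f"
    unfolding Cst_of_nat by (simp add: algebra_simps)
  also have "\<epsilon> f = 0"
    by (simp add: \<epsilon>_def f \<delta>3_f)
  finally have "Cst (of_nat (Suc n)) * u' * f = 0"
    by (rule sym)
  then have "u' = 0"
    using nonzero(4) by (simp del: of_nat_Suc)
  then show ?thesis
    using that[of k] \<epsilon>G \<epsilon>Z by (simp add: \<epsilon>_def)
qed

text \<open>Coefficients are found in the order \<open>\<delta>1\<close>, \<open>\<delta>3\<close>,
  \<open>\<delta>2\<close>: \<open>\<delta>3\<close> vanishes at \<open>t\<close>, and
  \<open>\<delta>2\<close> at \<open>t\<close>, \<open>z\<close> and \<open>G\<close>, so later
  corrections preserve earlier ones.\<close>

lemma span_\<delta>: "der_module.span {\<delta>1, \<delta>2, \<delta>3} = Der0 f"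
proof
  have "{\<delta>1, \<delta>2, \<delta>3} \<subseteq> Der0 f"
    using \<delta>_in_Der \<delta>1_f \<delta>2_f \<delta>3_f by (auto simp: Der0_def)
  then show "der_module.span {\<delta>1, \<delta>2, \<delta>3} \<subseteq> Der0 f"
    by (intro der_module.span_minimal Der0_subspace)
  show "Der0 f \<subseteq> der_module.span {\<delta>1, \<delta>2, \<delta>3}"
  proof
    fix \<delta> assume "\<delta> \<in> Der0 f"
    then have \<delta>: "\<delta> \<in> Der" and f: "\<delta> f = 0"
      by (auto simp: Der0_def)
    obtain k1 where k1: "\<delta> T = T * k1"
      using T_dvd_Der_T[OF \<delta> f] ..
    define \<epsilon> where "\<epsilon> = (\<lambda>p. \<delta> p - k1 * \<delta>1 p)"
    have \<epsilon>: "\<epsilon> \<in> Der" "\<epsilon> T = 0" "\<epsilon> f = 0"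
      unfolding \<epsilon>_def using Der_diff_scale[OF \<delta> \<delta>_in_Der(1)] by (simp_all add: k1 \<delta>_Var f \<delta>1_f)
    obtain k3 where k3: "\<epsilon> G = k3 * \<delta>3 G" "\<epsilon> Z = k3 * \<delta>3 Z"
      using Der_kills_T_decompose[OF \<epsilon>] .
    define \<zeta> where "\<zeta> = (\<lambda>p. \<epsilon> p - k3 * \<delta>3 p)"
    have "\<zeta> \<in> Der" "\<zeta> T = 0" "\<zeta> G = 0" "\<zeta> Z = 0"
      unfolding \<zeta>_def using Der_diff_scale[OF \<epsilon>(1) \<delta>_in_Der(3)]
      by (simp_all add: \<epsilon> \<delta>_Var k3)
    then obtain k2 where k2: "\<And>p. \<zeta> p = k2 * \<delta>2 p"
      using Der_kills_T_G_Z by metis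
    have "\<delta> = der_scale k1 \<delta>1 + (der_scale k2 \<delta>2 + der_scale k3 \<delta>3)"
      using k2 by (simp add: \<zeta>_def \<epsilon>_def der_scale_def fun_eq_iff algebra_simps)
    also have "\<dots> \<in> der_module.span {\<delta>1, \<delta>2, \<delta>3}"
      by (intro der_module.span_add der_module.span_scale der_module.span_base) simp_all
    finally show "\<delta> \<in> der_module.span {\<delta>1, \<delta>2, \<delta>3}" .
  qed
qed

section \<open>Freeness and the explicit form of the divisor\<close>

lemma free_f: "free_divisor_with_exponents f 1 (m - 1) (n * M)"
proof -
  have "homogeneous (1 + (m + n * M)) f"
    unfolding f_def by (intro homogeneous_mult homogeneous_Var homogeneous_GP)
  then show ?thesis
    unfolding free_divisor_with_exponents_def
    using squarefree_f distinct_\<delta> homogeneous_\<delta> independent_\<delta> span_\<delta> by blast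
qed

text \<open>\<open>G * P\<close> is homogeneous, not divisible by \<open>t\<close>, and becomes
  \<open>F_poly\<close> at \<open>t = 1\<close>; this determines the homogenization.\<close>

lemma homogenize_F_poly: "homogenize (F_poly \<Lambda> r0 r1 r2) = G * P"
proof -
  have "subst (Var(IT := 1)) (G * P) = F_poly \<Lambda> r0 r1 r2"
    by (simp add: F_poly_def G_def P_def H_def B_def)
  then show ?thesis
    using homogenize_subst_IT_1[OF homogeneous_GP not_T_dvd_GP] by simp
qed

lemma f_eq_if_sorted:
  assumes "r0 \<le> r1" "r1 \<le> r2"
  shows "f = T * (T ^ (r1 - r0) * X ^ r0 + Y ^ r1) *
    (\<Prod>\<alpha>\<in>\<Lambda>. T ^ (r2 - r0) * X ^ r0 + T ^ (r2 - r1) * Y ^ r1 + Cst \<alpha> * Z ^ r2)"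
proof -
  have m: "m = r1" and M: "M = r2"
    using assms by (auto simp: m_def M_def)
  have G: "G = T ^ (r1 - r0) * X ^ r0 + Y ^ r1"
    by (simp add: G_def m)
  have "T ^ (r2 - r1) * T ^ (r1 - r0) = T ^ (r2 - r0)"
    using assms by (simp flip: power_add)
  then have "H \<alpha> = T ^ (r2 - r0) * X ^ r0 + T ^ (r2 - r1) * Y ^ r1 + Cst \<alpha> * Z ^ r2" for \<alpha>
    by (simp add: H_def G B_def m M distrib_left flip: mult.assoc)
  then show ?thesis
    by (simp only: f_def G P_def mult.assoc)
qed

end

theorem theorem6p16:
  fixes \<Lambda> :: "'a::field_char_0 set" and r0 r1 r2 :: nat
  assumes "finite \<Lambda>" and "0 \<notin> \<Lambda>"
    and "r0 > 0" and "r1 > 0" and "r2 > 0"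
  shows "free_divisor_with_exponents (Var IT * homogenize (F_poly \<Lambda> r0 r1 r2))
           1 (max r0 r1 - 1) (card \<Lambda> * max r0 (max r1 r2)) \<and>
         (r0 \<le> r1 \<and> r1 \<le> r2 \<longrightarrow>
           free_divisor_with_exponents
             (Var IT * (Var IT ^ (r1 - r0) * Var IX ^ r0 + Var IY ^ r1) *
              (\<Prod>\<alpha>\<in>\<Lambda>. Var IT ^ (r2 - r0) * Var IX ^ r0 + Var IT ^ (r2 - r1) * Var IY ^ r1
                          + Cst \<alpha> * Var IZ ^ r2))
             1 (r1 - 1) (card \<Lambda> * r2))"
proof -
  interpret arrangement \<Lambda> r0 r1 r2
    using assms by unfold_locales
  have "Var IT * homogenize (F_poly \<Lambda> r0 r1 r2) = f"
    by (simp add: homogenize_F_poly f_def)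
  moreover have "m = r1 \<and> M = r2" if "r0 \<le> r1" "r1 \<le> r2"
    using that by (auto simp: m_def M_def)
  ultimately show ?thesis
    using free_f f_eq_if_sorted unfolding m_def M_def by auto
qed

end
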